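(* Every von Neumann regular commutative ring is CFQ.
   Context: A commutative ring $R$ is von Neumann regular if for every $a \in R$ there is $b\in R$ with $aba=a$. For a commutative ring $R$, an $R$-module $C$ is almost cotorsion if $\mathrm{Ext}^1_R(S^{-1}R, C) = 0$ for every (at most) countable multiplicative subset $S \subseteq R$; an $R$-module $F$ is quite flat if $\mathrm{Ext}^1_R(F, C) = 0$ for every almost cotorsion $R$-module $C$. A commutative ring $R$ is called CFQ if every countably presented flat $R$-module is quite flat. *)

theory Defs
  imports "HOL-Algebra.Module" "HOL-Algebra.Ideal" "HOL-Library.Countable_Set"
begin

definition von_neumann_regular :: "'a ring \<Rightarrow> bool" where
  "von_neumann_regular R \<longleftrightarrow>
     (\<forall>a\<in>carrier R. \<exists>b\<in>carrier R. a \<otimes>\<^bsub>R\<^esub> b \<otimes>\<^bsub>R\<^esub> a = a)"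

definition mod_hom :: "'a ring \<Rightarrow> ('a,'b) module \<Rightarrow> ('a,'c) module \<Rightarrow> ('b \<Rightarrow> 'c) \<Rightarrow> bool" where
  "mod_hom R M N f \<longleftrightarrow>
     f \<in> carrier M \<rightarrow> carrier N \<and>
     (\<forall>x\<in>carrier M. \<forall>y\<in>carrier M. f (x \<oplus>\<^bsub>M\<^esub> y) = f x \<oplus>\<^bsub>N\<^esub> f y) \<and>
     (\<forall>r\<in>carrier R. \<forall>x\<in>carrier M. f (r \<odot>\<^bsub>M\<^esub> x) = r \<odot>\<^bsub>N\<^esub> f x)"

text \<open>Ext^1_R(A,C) = 0 iff every short exact sequence 0 -> C -> B -> A -> 0 of
  R-modules splits. Every such extension is isomorphic to one whose underlying
  set is a subset of C x A, so it suffices to let B range over modules whose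
  elements have type 'c \<times> 'x.\<close>
definition ext1_vanishes :: "'a ring \<Rightarrow> ('a,'x) module \<Rightarrow> ('a,'c) module \<Rightarrow> bool" where
  "ext1_vanishes R A C \<longleftrightarrow>
     (\<forall>(B :: ('a, 'c \<times> 'x) module) f g.
        module R B \<and> mod_hom R C B f \<and> mod_hom R B A g \<and>
        inj_on f (carrier C) \<and> g ` carrier B = carrier A \<and>
        f ` carrier C = {b \<in> carrier B. g b = \<zero>\<^bsub>A\<^esub>}
        \<longrightarrow> (\<exists>s. mod_hom R A B s \<and> (\<forall>x\<in>carrier A. g (s x) = x)))"

definition mult_subset :: "'a ring \<Rightarrow> 'a set \<Rightarrow> bool" where
  "mult_subset R S \<longleftrightarrow> S \<subseteq> carrier R \<and> \<one>\<^bsub>R\<^esub> \<in> S \<and>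
     (\<forall>s\<in>S. \<forall>t\<in>S. s \<otimes>\<^bsub>R\<^esub> t \<in> S)"

definition loc_rel :: "'a ring \<Rightarrow> 'a set \<Rightarrow> (('a \<times> 'a) \<times> ('a \<times> 'a)) set" where
  "loc_rel R S = {((r, s), (r', s')). r \<in> carrier R \<and> s \<in> S \<and> r' \<in> carrier R \<and> s' \<in> S \<and>
      (\<exists>t\<in>S. t \<otimes>\<^bsub>R\<^esub> (r \<otimes>\<^bsub>R\<^esub> s' \<ominus>\<^bsub>R\<^esub> r' \<otimes>\<^bsub>R\<^esub> s) = \<zero>\<^bsub>R\<^esub>)}"

definition rep :: "'b set \<Rightarrow> 'b" where
  "rep X = (SOME p. p \<in> X)"

text \<open>Fractions r/s are equivalence classes of pairs (r,s); operations are
  computed on chosen representatives (they are well defined).\<close>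
definition loc_module :: "'a ring \<Rightarrow> 'a set \<Rightarrow> ('a, ('a \<times> 'a) set) module" where
  "loc_module R S =
     \<lparr>carrier = (carrier R \<times> S) // loc_rel R S,
      mult = (\<lambda>X Y. loc_rel R S `` {(fst (rep X) \<otimes>\<^bsub>R\<^esub> fst (rep Y), snd (rep X) \<otimes>\<^bsub>R\<^esub> snd (rep Y))}),
      one = loc_rel R S `` {(\<one>\<^bsub>R\<^esub>, \<one>\<^bsub>R\<^esub>)},
      zero = loc_rel R S `` {(\<zero>\<^bsub>R\<^esub>, \<one>\<^bsub>R\<^esub>)},
      add = (\<lambda>X Y. loc_rel R S ``
               {(fst (rep X) \<otimes>\<^bsub>R\<^esub> snd (rep Y) \<oplus>\<^bsub>R\<^esub> fst (rep Y) \<otimes>\<^bsub>R\<^esub> snd (rep X),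
                 snd (rep X) \<otimes>\<^bsub>R\<^esub> snd (rep Y))}),
      smult = (\<lambda>a X. loc_rel R S `` {(a \<otimes>\<^bsub>R\<^esub> fst (rep X), snd (rep X))})\<rparr>"

definition almost_cotorsion :: "'a ring \<Rightarrow> ('a,'c) module \<Rightarrow> bool" where
  "almost_cotorsion R C \<longleftrightarrow>
     (\<forall>S. mult_subset R S \<and> countable S \<longrightarrow> ext1_vanishes R (loc_module R S) C)"

text \<open>F is quite flat: Ext^1(F,C) = 0 for all almost cotorsion C. The type
  argument fixes the element type of the test modules C; a theorem with a free
  type variable there quantifies over all of them.\<close>
definition quite_flat :: "'a ring \<Rightarrow> ('a,'f) module \<Rightarrow> 'c itself \<Rightarrow> bool" where
  "quite_flat R F (_ :: 'c itself) \<longleftrightarrow>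
     (\<forall>C :: ('a,'c) module. module R C \<and> almost_cotorsion R C \<longrightarrow> ext1_vanishes R F C)"

definition free_nat_module :: "'a ring \<Rightarrow> ('a, nat \<Rightarrow> 'a) module" where
  "free_nat_module R =
     \<lparr>carrier = {u. (\<forall>n. u n \<in> carrier R) \<and> finite {n. u n \<noteq> \<zero>\<^bsub>R\<^esub>}},
      mult = (\<lambda>u v n. \<zero>\<^bsub>R\<^esub>),
      one = (\<lambda>n. \<zero>\<^bsub>R\<^esub>),
      zero = (\<lambda>n. \<zero>\<^bsub>R\<^esub>),
      add = (\<lambda>u v n. u n \<oplus>\<^bsub>R\<^esub> v n),
      smult = (\<lambda>r u n. r \<otimes>\<^bsub>R\<^esub> u n)\<rparr>"

definition submodule_gen :: "'a ring \<Rightarrow> ('a,'b) module \<Rightarrow> 'b set \<Rightarrow> 'b set" where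
  "submodule_gen R M K = \<Inter> {N. submodule N R M \<and> K \<subseteq> N}"

definition countably_presented :: "'a ring \<Rightarrow> ('a,'f) module \<Rightarrow> bool" where
  "countably_presented R F \<longleftrightarrow>
     (\<exists>\<pi>. mod_hom R (free_nat_module R) F \<pi> \<and>
          \<pi> ` carrier (free_nat_module R) = carrier F \<and>
          (\<exists>K. countable K \<and> K \<subseteq> carrier (free_nat_module R) \<and>
               {u \<in> carrier (free_nat_module R). \<pi> u = \<zero>\<^bsub>F\<^esub>} = submodule_gen R (free_nat_module R) K))"

text \<open>The tensor product I \<otimes>_R F is the free abelian group on I \<times> F (finitely
  supported int-valued functions) modulo the subgroup generated by the
  bilinearity/balancing relations.\<close>
definition delta :: "'b \<Rightarrow> 'b \<Rightarrow> int" where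
  "delta p = (\<lambda>q. if q = p then 1 else 0)"

inductive_set int_span :: "('b \<Rightarrow> int) set \<Rightarrow> ('b \<Rightarrow> int) set" for G where
  zero: "(\<lambda>_. 0) \<in> int_span G"
| gen: "g \<in> G \<Longrightarrow> g \<in> int_span G"
| add: "u \<in> int_span G \<Longrightarrow> v \<in> int_span G \<Longrightarrow> (\<lambda>q. u q + v q) \<in> int_span G"
| neg: "u \<in> int_span G \<Longrightarrow> (\<lambda>q. - u q) \<in> int_span G"

definition tensor_relations :: "'a ring \<Rightarrow> 'a set \<Rightarrow> ('a,'f) module \<Rightarrow> ('a \<times> 'f \<Rightarrow> int) set" where
  "tensor_relations R I F =
     {(\<lambda>q. delta (i \<oplus>\<^bsub>R\<^esub> i', x) q - delta (i, x) q - delta (i', x) q) | i i' x.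
        i \<in> I \<and> i' \<in> I \<and> x \<in> carrier F} \<union>
     {(\<lambda>q. delta (i, x \<oplus>\<^bsub>F\<^esub> x') q - delta (i, x) q - delta (i, x') q) | i x x'.
        i \<in> I \<and> x \<in> carrier F \<and> x' \<in> carrier F} \<union>
     {(\<lambda>q. delta (r \<otimes>\<^bsub>R\<^esub> i, x) q - delta (i, r \<odot>\<^bsub>F\<^esub> x) q) | r i x.
        r \<in> carrier R \<and> i \<in> I \<and> x \<in> carrier F}"

text \<open>The map I \<otimes>_R F -> R \<otimes>_R F = F, i \<otimes> x \<mapsto> i x, on formal sums.\<close>
definition tensor_mult_map :: "('a,'f) module \<Rightarrow> ('a \<times> 'f \<Rightarrow> int) \<Rightarrow> 'f" where
  "tensor_mult_map F u =
     (\<Oplus>\<^bsub>F\<^esub> p \<in> {p. u p \<noteq> 0}. add_pow F (u p) (fst p \<odot>\<^bsub>F\<^esub> snd p))"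

text \<open>F is flat iff I \<otimes>_R F -> R \<otimes>_R F is injective for every ideal I of R.\<close>
definition flat :: "'a ring \<Rightarrow> ('a,'f) module \<Rightarrow> bool" where
  "flat R F \<longleftrightarrow>
     (\<forall>I. ideal I R \<longrightarrow>
        (\<forall>u. finite {p. u p \<noteq> 0} \<and> {p. u p \<noteq> 0} \<subseteq> I \<times> carrier F \<and>
             tensor_mult_map F u = \<zero>\<^bsub>F\<^esub>
             \<longrightarrow> u \<in> int_span (tensor_relations R I F)))"

text \<open>R is CFQ: every countably presented flat R-module is quite flat. The type
  arguments fix element types of F and of the test modules C; with free type
  variables the statement covers all modules.\<close>
definition CFQ :: "'a ring \<Rightarrow> 'f itself \<Rightarrow> 'c itself \<Rightarrow> bool" where
  "CFQ R (_ :: 'f itself) (_ :: 'c itself) \<longleftrightarrow>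
     (\<forall>F :: ('a,'f) module. module R F \<and> countably_presented R F \<and> flat R F
        \<longrightarrow> quite_flat R F TYPE('c))"

end

theory Submission
  imports Defs
begin

text \<open>
  Write $F = R^{(\mathbb{N})}/K$ with $K$ countably generated. As $R^{(\mathbb{N})}$ is projective,
  $\mathrm{Ext}^1(F, C) = 0$ as soon as every linear map $h : K \to C$ extends to
  $R^{(\mathbb{N})}$, that is, has the form $h(u) = \sum_i u_i c_i$. The coefficients are found one
  after the other: if $c_0, \dots, c_{n-1}$ represent $h$ on $K \cap R^n$, then the error
  $h(u) - \sum_{i<n} u_i c_i$ on $K \cap R^{n+1}$ depends only on the coordinate $u_n$, hence is a
  linear map $I_n \to C$ on the ideal $I_n$ of these coordinates, and $c_n$ exists if it extends to
  $R$, for which $\mathrm{Ext}^1(R/I_n, C) = 0$ suffices. Over a von Neumann regular ring the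
  intersection of a finitely generated submodule of $R^{(\mathbb{N})}$ with $R^{n+1}$ is finitely
  generated, so $I_n$ is countably generated; and then $R/I_n$ is the localization of $R$ at a
  countable multiplicative set, so $\mathrm{Ext}^1(R/I_n, C) = 0$ for almost cotorsion $C$.
\<close>

section \<open>Linear maps\<close>

lemma (in abelian_group) minus_eq_zero_iff:
  assumes "x \<in> carrier G" "y \<in> carrier G"
  shows "x \<ominus> y = \<zero> \<longleftrightarrow> x = y"
  using assms add.inv_solve_right[of \<zero> x y] by (auto simp: a_minus_def)

lemma (in abelian_group) minus_zero_right: "x \<in> carrier G \<Longrightarrow> x \<ominus> \<zero> = x"
  using add.inv_one by (simp add: a_minus_def)

lemma mod_homI:
  assumes "\<And>x. x \<in> carrier M \<Longrightarrow> f x \<in> carrier N"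
    and "\<And>x y. x \<in> carrier M \<Longrightarrow> y \<in> carrier M \<Longrightarrow> f (x \<oplus>\<^bsub>M\<^esub> y) = f x \<oplus>\<^bsub>N\<^esub> f y"
    and "\<And>r x. r \<in> carrier R \<Longrightarrow> x \<in> carrier M \<Longrightarrow> f (r \<odot>\<^bsub>M\<^esub> x) = r \<odot>\<^bsub>N\<^esub> f x"
  shows "mod_hom R M N f"
  using assms by (auto simp: mod_hom_def)

lemma mod_hom_closed: "mod_hom R M N f \<Longrightarrow> x \<in> carrier M \<Longrightarrow> f x \<in> carrier N"
  by (auto simp: mod_hom_def)

lemma mod_hom_add:
  "mod_hom R M N f \<Longrightarrow> x \<in> carrier M \<Longrightarrow> y \<in> carrier M \<Longrightarrow> f (x \<oplus>\<^bsub>M\<^esub> y) = f x \<oplus>\<^bsub>N\<^esub> f y"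
  by (auto simp: mod_hom_def)

lemma mod_hom_smult:
  "mod_hom R M N f \<Longrightarrow> r \<in> carrier R \<Longrightarrow> x \<in> carrier M \<Longrightarrow> f (r \<odot>\<^bsub>M\<^esub> x) = r \<odot>\<^bsub>N\<^esub> f x"
  by (auto simp: mod_hom_def)

lemma mod_hom_zero:
  assumes "module R M" "module R N" "mod_hom R M N f"
  shows "f \<zero>\<^bsub>M\<^esub> = \<zero>\<^bsub>N\<^esub>"
proof -
  interpret M: module R M by fact
  interpret N: module R N by fact
  have "f (\<zero>\<^bsub>R\<^esub> \<odot>\<^bsub>M\<^esub> \<zero>\<^bsub>M\<^esub>) = \<zero>\<^bsub>R\<^esub> \<odot>\<^bsub>N\<^esub> f \<zero>\<^bsub>M\<^esub>"
    by (rule mod_hom_smult[OF assms(3)]) auto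
  then show ?thesis using mod_hom_closed[OF assms(3)] by simp
qed

lemma mod_hom_minus:
  assumes "module R M" "module R N" "mod_hom R M N f" "x \<in> carrier M" "y \<in> carrier M"
  shows "f (x \<ominus>\<^bsub>M\<^esub> y) = f x \<ominus>\<^bsub>N\<^esub> f y"
proof -
  interpret M: module R M by fact
  interpret N: module R N by fact
  have "f (\<ominus>\<^bsub>M\<^esub> y) = f ((\<ominus>\<^bsub>R\<^esub> \<one>\<^bsub>R\<^esub>) \<odot>\<^bsub>M\<^esub> y)"
    using assms(5) by (simp add: M.smult_l_minus)
  also have "\<dots> = (\<ominus>\<^bsub>R\<^esub> \<one>\<^bsub>R\<^esub>) \<odot>\<^bsub>N\<^esub> f y"
    using assms(5) by (intro mod_hom_smult[OF assms(3)]) auto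
  also have "\<dots> = \<ominus>\<^bsub>N\<^esub> f y"
    using mod_hom_closed[OF assms(3,5)] by (simp add: N.smult_l_minus)
  finally show ?thesis
    using assms(4,5) by (simp add: a_minus_def mod_hom_add[OF assms(3)])
qed

lemma mod_hom_eq_iff:
  assumes "module R M" "module R N" "mod_hom R M N f" "x \<in> carrier M" "y \<in> carrier M"
  shows "f x = f y \<longleftrightarrow> f (x \<ominus>\<^bsub>M\<^esub> y) = \<zero>\<^bsub>N\<^esub>"
proof -
  interpret N: module R N by fact
  show ?thesis
    using mod_hom_closed[OF assms(3)] assms(4,5)
    by (simp add: mod_hom_minus[OF assms] N.M.minus_eq_zero_iff)
qed

lemma mod_hom_comp:
  "mod_hom R L M f \<Longrightarrow> mod_hom R M N g \<Longrightarrow> mod_hom R L N (\<lambda>x. g (f x))"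
  by (auto simp: mod_hom_def Pi_iff)

lemma mod_hom_diff:
  assumes "module R N" "mod_hom R M N f" "mod_hom R M N g"
  shows "mod_hom R M N (\<lambda>x. f x \<ominus>\<^bsub>N\<^esub> g x)"
proof -
  interpret N: module R N by fact
  show ?thesis
    using assms(2,3)
    by (auto simp: mod_hom_def Pi_iff a_minus_def N.M.minus_add N.M.a_ac
        N.smult_r_distr N.smult_r_minus)
qed

lemma mod_hom_restrict:
  "mod_hom R M N f \<Longrightarrow> P \<subseteq> carrier M \<Longrightarrow> mod_hom R (M\<lparr>carrier := P\<rparr>) N f"
  by (auto simp: mod_hom_def Pi_iff subset_iff)

lemma mod_hom_onto_image:
  "mod_hom R M N f \<Longrightarrow> mod_hom R M (N\<lparr>carrier := f ` carrier M\<rparr>) f"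
  by (auto simp: mod_hom_def)

lemma mod_hom_factor_surj:
  assumes "module R M" "module R A" "module R B"
    and p: "mod_hom R M A p" and surj: "p ` carrier M = carrier A"
    and \<sigma>: "mod_hom R M B \<sigma>"
    and kernel: "\<And>x. x \<in> carrier M \<Longrightarrow> p x = \<zero>\<^bsub>A\<^esub> \<Longrightarrow> \<sigma> x = \<zero>\<^bsub>B\<^esub>"
  obtains s where "mod_hom R A B s" "\<And>x. x \<in> carrier M \<Longrightarrow> s (p x) = \<sigma> x"
proof
  interpret M: module R M by fact
  define s where "s = (\<lambda>a. \<sigma> (inv_into (carrier M) p a))"
  have \<sigma>_cong: "\<sigma> x = \<sigma> y" if "x \<in> carrier M" "y \<in> carrier M" "p x = p y" for x y
    using that kernel mod_hom_eq_iff[OF assms(1,2) p] mod_hom_eq_iff[OF assms(1,3) \<sigma>] by simp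
  show s: "s (p x) = \<sigma> x" if "x \<in> carrier M" for x
    unfolding s_def using that by (intro \<sigma>_cong inv_into_into f_inv_into_f) auto
  show "mod_hom R A B s"
    unfolding mod_hom_def Pi_iff surj[symmetric]
    by (auto simp: s mod_hom_closed[OF \<sigma>] mod_hom_add[OF \<sigma>] mod_hom_smult[OF \<sigma>]
        mod_hom_add[OF p, symmetric] mod_hom_smult[OF p, symmetric])
qed

lemma mod_hom_factor_inj:
  assumes "module R X" "module R C"
    and f: "mod_hom R C B f" and inj: "inj_on f (carrier C)"
    and \<sigma>: "mod_hom R X B \<sigma>" and image: "\<sigma> ` carrier X \<subseteq> f ` carrier C"
  obtains h where "mod_hom R X C h" "\<And>x. x \<in> carrier X \<Longrightarrow> f (h x) = \<sigma> x"
proof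
  interpret X: module R X by fact
  interpret C: module R C by fact
  define h where "h = (\<lambda>x. inv_into (carrier C) f (\<sigma> x))"
  have h_closed: "h x \<in> carrier C" if "x \<in> carrier X" for x
    unfolding h_def using image that by (intro inv_into_into) auto
  show fh: "f (h x) = \<sigma> x" if "x \<in> carrier X" for x
    unfolding h_def using image that by (intro f_inv_into_f) auto
  have h_eq: "h x = c" if "x \<in> carrier X" "c \<in> carrier C" "\<sigma> x = f c" for x c
    using that inj fh h_closed by (metis inj_onD)
  show "mod_hom R X C h"
    by (intro mod_homI h_eq)
      (auto simp: h_closed fh mod_hom_add[OF f] mod_hom_add[OF \<sigma>]
        mod_hom_smult[OF f] mod_hom_smult[OF \<sigma>])
qed

section \<open>Submodules and generators\<close>

lemma (in module) submodule_zero_closed: "submodule P R M \<Longrightarrow> \<zero>\<^bsub>M\<^esub> \<in> P"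
  using subgroup.one_closed[OF submodule.axioms(1)] by simp

lemma (in module) submoduleI_smult:
  assumes "P \<subseteq> carrier M" "\<zero>\<^bsub>M\<^esub> \<in> P"
    and "\<And>x y. x \<in> P \<Longrightarrow> y \<in> P \<Longrightarrow> x \<oplus>\<^bsub>M\<^esub> y \<in> P"
    and smult: "\<And>r x. r \<in> carrier R \<Longrightarrow> x \<in> P \<Longrightarrow> r \<odot>\<^bsub>M\<^esub> x \<in> P"
  shows "submodule P R M"
proof (rule submoduleI)
  show "\<ominus>\<^bsub>M\<^esub> x \<in> P" if "x \<in> P" for x
    using smult[of "\<ominus>\<^bsub>R\<^esub> \<one>\<^bsub>R\<^esub>" x] that assms(1) by (auto simp: smult_l_minus)
qed (use assms in auto)

lemma (in module) submodule_zero: "submodule {\<zero>\<^bsub>M\<^esub>} R M"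
  by (rule submoduleI_smult) auto

lemma submodule_vimage:
  assumes "module R M" "module R N" and f: "mod_hom R M N f" and Q: "submodule Q R N"
  shows "submodule {x \<in> carrier M. f x \<in> Q} R M"
proof -
  interpret M: module R M by fact
  interpret N: module R N by fact
  show ?thesis
    by (rule M.submoduleI_smult)
      (auto simp: mod_hom_zero[OF assms(1,2) f] mod_hom_add[OF f] mod_hom_smult[OF f]
        N.submodule_zero_closed[OF Q] N.submoduleE(4,5)[OF Q])
qed

lemma submodule_kernel:
  assumes "module R M" "module R N" "mod_hom R M N f"
  shows "submodule {x \<in> carrier M. f x = \<zero>\<^bsub>N\<^esub>} R M"
  using submodule_vimage[OF assms module.submodule_zero[OF assms(2)]] by simp

lemma submodule_image:
  assumes "module R M" "module R N" and f: "mod_hom R M N f" and P: "submodule P R M"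
  shows "submodule (f ` P) R N"
proof -
  interpret M: module R M by fact
  interpret N: module R N by fact
  note P_closed = M.submoduleE(4,5)[OF P] M.submodule_zero_closed[OF P]
  have PM: "x \<in> carrier M" if "x \<in> P" for x using that M.submoduleE(1)[OF P] by auto
  show ?thesis
  proof (rule N.submoduleI_smult)
    show "f ` P \<subseteq> carrier N" using PM mod_hom_closed[OF f] by auto
    show "\<zero>\<^bsub>N\<^esub> \<in> f ` P" using P_closed(3) mod_hom_zero[OF assms(1,2) f] by force
    show "x \<oplus>\<^bsub>N\<^esub> y \<in> f ` P" if "x \<in> f ` P" "y \<in> f ` P" for x y
      using that P_closed(2) by (auto simp: PM mod_hom_add[OF f, symmetric])
    show "r \<odot>\<^bsub>N\<^esub> x \<in> f ` P" if "r \<in> carrier R" "x \<in> f ` P" for r x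
      using that P_closed(1) by (auto simp: PM mod_hom_smult[OF f, symmetric])
  qed
qed

lemma submodule_gen_incl: "G \<subseteq> submodule_gen R M G"
  unfolding submodule_gen_def by blast

lemma submodule_gen_minimal: "submodule N R M \<Longrightarrow> G \<subseteq> N \<Longrightarrow> submodule_gen R M G \<subseteq> N"
  unfolding submodule_gen_def by blast

lemma submodule_gen_mono: "G \<subseteq> H \<Longrightarrow> submodule_gen R M G \<subseteq> submodule_gen R M H"
  unfolding submodule_gen_def by blast

context
  fixes R :: "'a ring" and M :: "('a,'b) module"
  assumes module: "module R M"
begin

interpretation module R M by (rule module)

lemma submodule_gen_submodule:
  assumes "G \<subseteq> carrier M"
  shows "submodule (submodule_gen R M G) R M"
proof (rule submoduleI_smult)
  show "submodule_gen R M G \<subseteq> carrier M"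
    by (rule submodule_gen_minimal[OF carrier_is_submodule assms])
qed (auto simp: submodule_gen_def submodule_zero_closed submoduleE(4,5))

lemma submodule_gen_closed:
  "G \<subseteq> carrier M \<Longrightarrow> x \<in> submodule_gen R M G \<Longrightarrow> x \<in> carrier M"
  using submoduleE(1)[OF submodule_gen_submodule] by auto

lemma submodule_gen_finitary:
  assumes "G \<subseteq> carrier M"
  shows "submodule_gen R M G = (\<Union>A\<in>{A. finite A \<and> A \<subseteq> G}. submodule_gen R M A)"
    (is "_ = ?U")
proof
  show "?U \<subseteq> submodule_gen R M G" using submodule_gen_mono by blast
  have sub: "submodule (submodule_gen R M A) R M" if "A \<subseteq> G" for A
    using that assms by (intro submodule_gen_submodule) auto
  have "submodule ?U R M"
  proof (rule submoduleI_smult)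
    show "?U \<subseteq> carrier M" using sub submoduleE(1) by blast
    show "\<zero>\<^bsub>M\<^esub> \<in> ?U" using submodule_zero_closed[OF sub[of "{}"]] by blast
    show "x \<oplus>\<^bsub>M\<^esub> y \<in> ?U" if xy: "x \<in> ?U" "y \<in> ?U" for x y
    proof -
      obtain A B where A: "finite A" "A \<subseteq> G" "x \<in> submodule_gen R M A"
        and B: "finite B" "B \<subseteq> G" "y \<in> submodule_gen R M B"
        using xy by blast
      have "x \<oplus>\<^bsub>M\<^esub> y \<in> submodule_gen R M (A \<union> B)"
      proof (rule submoduleE(5)[OF sub])
        show "x \<in> submodule_gen R M (A \<union> B)"
          using A(3) submodule_gen_mono[of A "A \<union> B" R M] by auto
        show "y \<in> submodule_gen R M (A \<union> B)"
          using B(3) submodule_gen_mono[of B "A \<union> B" R M] by auto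
      qed (use A B in auto)
      then show ?thesis using A B by blast
    qed
    show "r \<odot>\<^bsub>M\<^esub> x \<in> ?U" if "r \<in> carrier R" "x \<in> ?U" for r x
      using that submoduleE(4)[OF sub] by blast
  qed
  moreover have "G \<subseteq> ?U"
  proof
    fix x assume "x \<in> G"
    then show "x \<in> ?U" using submodule_gen_incl[of "{x}" R M] by (intro UN_I[of "{x}"]) auto
  qed
  ultimately show "submodule_gen R M G \<subseteq> ?U" by (rule submodule_gen_minimal)
qed

end

lemma image_submodule_gen:
  assumes "module R M" "module R N" and f: "mod_hom R M N f" and G: "G \<subseteq> carrier M"
  shows "f ` submodule_gen R M G = submodule_gen R N (f ` G)"
proof
  interpret M: module R M by fact
  interpret N: module R N by fact
  have fG: "f ` G \<subseteq> carrier N" using G mod_hom_closed[OF f] by auto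
  have "submodule_gen R M G \<subseteq> {x \<in> carrier M. f x \<in> submodule_gen R N (f ` G)}"
    using submodule_vimage[OF assms(1-3) submodule_gen_submodule[OF assms(2) fG]] G
      submodule_gen_incl[of "f ` G" R N]
    by (intro submodule_gen_minimal) auto
  then show "f ` submodule_gen R M G \<subseteq> submodule_gen R N (f ` G)" by auto
  show "submodule_gen R N (f ` G) \<subseteq> f ` submodule_gen R M G"
    using submodule_image[OF assms(1-3) submodule_gen_submodule[OF assms(1) G]] submodule_gen_incl
    by (intro submodule_gen_minimal image_mono)
qed

definition finitely_generated :: "'a ring \<Rightarrow> ('a,'b) module \<Rightarrow> 'b set \<Rightarrow> bool" where
  "finitely_generated R M P \<longleftrightarrow> (\<exists>G. finite G \<and> G \<subseteq> carrier M \<and> P = submodule_gen R M G)"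

definition countably_generated :: "'a ring \<Rightarrow> ('a,'b) module \<Rightarrow> 'b set \<Rightarrow> bool" where
  "countably_generated R M P \<longleftrightarrow> (\<exists>G. countable G \<and> G \<subseteq> carrier M \<and> P = submodule_gen R M G)"

lemma finitely_generated_submodule:
  "module R M \<Longrightarrow> finitely_generated R M P \<Longrightarrow> submodule P R M"
  unfolding finitely_generated_def using submodule_gen_submodule by blast

lemma countably_generated_submodule:
  "module R M \<Longrightarrow> countably_generated R M P \<Longrightarrow> submodule P R M"
  unfolding countably_generated_def using submodule_gen_submodule by blast

lemma finitely_generated_image:
  assumes "module R M" "module R N" "mod_hom R M N f" "finitely_generated R M P"
  shows "finitely_generated R N (f ` P)"
proof -
  obtain G where G: "finite G" "G \<subseteq> carrier M" "P = submodule_gen R M G"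
    using assms(4) unfolding finitely_generated_def by blast
  then have "f ` P = submodule_gen R N (f ` G)" "f ` G \<subseteq> carrier N"
    using image_submodule_gen[OF assms(1-3) G(2)] mod_hom_closed[OF assms(3)] by auto
  then show ?thesis unfolding finitely_generated_def using G(1) by blast
qed

lemma countably_generated_UN:
  assumes "module R M" and sub: "submodule (\<Union>i\<in>I. P i) R M" and I: "countable I"
    and P: "\<And>i. i \<in> I \<Longrightarrow> finitely_generated R M (P i)"
  shows "countably_generated R M (\<Union>i\<in>I. P i)"
proof -
  interpret module R M by fact
  obtain G where G: "\<And>i. i \<in> I \<Longrightarrow> finite (G i) \<and> G i \<subseteq> carrier M \<and> P i = submodule_gen R M (G i)"
    using P unfolding finitely_generated_def by metis
  have "(\<Union>i\<in>I. P i) = submodule_gen R M (\<Union>i\<in>I. G i)"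
  proof
    show "(\<Union>i\<in>I. P i) \<subseteq> submodule_gen R M (\<Union>i\<in>I. G i)"
    proof (rule UN_least)
      fix i assume "i \<in> I"
      then show "P i \<subseteq> submodule_gen R M (\<Union>i\<in>I. G i)"
        using G[of i] submodule_gen_mono[of "G i" "\<Union>i\<in>I. G i" R M] by auto
    qed
    show "submodule_gen R M (\<Union>i\<in>I. G i) \<subseteq> (\<Union>i\<in>I. P i)"
    proof (rule submodule_gen_minimal[OF sub], rule UN_mono[OF subset_refl])
      fix i assume "i \<in> I"
      then show "G i \<subseteq> P i" using G[of i] submodule_gen_incl[of "G i" R M] by simp
    qed
  qed
  moreover have "countable (\<Union>i\<in>I. G i)" "(\<Union>i\<in>I. G i) \<subseteq> carrier M"
    using G I by (auto intro: countable_finite)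
  ultimately show ?thesis unfolding countably_generated_def by blast
qed

section \<open>Homomorphic images and products\<close>

lemma module_surj_image:
  assumes "module R M" and p: "mod_hom R M A p" and surj: "p ` carrier M = carrier A"
    and zero: "\<zero>\<^bsub>A\<^esub> = p \<zero>\<^bsub>M\<^esub>"
  shows "module R A"
proof -
  interpret M: module R M by fact
  have add: "p x \<oplus>\<^bsub>A\<^esub> p y = p (x \<oplus>\<^bsub>M\<^esub> y)" if "x \<in> carrier M" "y \<in> carrier M" for x y
    using mod_hom_add[OF p] that by simp
  have smult: "r \<odot>\<^bsub>A\<^esub> p x = p (r \<odot>\<^bsub>M\<^esub> x)" if "r \<in> carrier R" "x \<in> carrier M" for r x
    using mod_hom_smult[OF p] that by simp
  show ?thesis
  proof (rule moduleI[OF M.is_cring abelian_groupI])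
    fix a assume "a \<in> carrier A"
    then obtain x where x: "x \<in> carrier M" "a = p x" using surj by blast
    then show "\<exists>b\<in>carrier A. b \<oplus>\<^bsub>A\<^esub> a = \<zero>\<^bsub>A\<^esub>"
      by (intro bexI[of _ "p (\<ominus>\<^bsub>M\<^esub> x)"]) (auto simp: add zero M.M.l_neg mod_hom_closed[OF p])
  qed (auto simp: surj[symmetric] zero add smult
      M.M.a_ac M.smult_l_distr M.smult_r_distr M.smult_assoc1)
qed

definition regular_module :: "('a,'k) ring_scheme \<Rightarrow> ('a,'a) module" where
  "regular_module R = \<lparr>carrier = carrier R, mult = mult R, one = \<one>\<^bsub>R\<^esub>, zero = \<zero>\<^bsub>R\<^esub>,
     add = add R, smult = mult R\<rparr>"

lemma regular_module_simps [simp]: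
  "carrier (regular_module R) = carrier R"
  "zero (regular_module R) = \<zero>\<^bsub>R\<^esub>"
  "add (regular_module R) = add R"
  "smult (regular_module R) = mult R"
  by (simp_all add: regular_module_def)

lemma minus_regular_module [simp]: "x \<ominus>\<^bsub>regular_module R\<^esub> y = x \<ominus>\<^bsub>R\<^esub> y"
  by (simp add: a_minus_def a_inv_def m_inv_def)

lemma (in cring) module_regular_module: "module R (regular_module R)"
proof (rule moduleI[OF is_cring abelian_groupI])
  fix x assume "x \<in> carrier (regular_module R)"
  then show "\<exists>y\<in>carrier (regular_module R). y \<oplus>\<^bsub>regular_module R\<^esub> x = \<zero>\<^bsub>regular_module R\<^esub>"
    by (intro bexI[of _ "\<ominus> x"]) (auto simp: l_neg)
qed (auto simp: a_ac m_ac l_distr r_distr)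

lemma (in cring) submodule_regular_module_iff_ideal:
  "submodule I R (regular_module R) \<longleftrightarrow> ideal I R"
proof
  assume I: "submodule I R (regular_module R)"
  note closed = module.submoduleE(1,4)[OF module_regular_module I, simplified]
  have "subgroup I (add_monoid R)"
    using submodule.axioms(1)[OF I] by (simp add: subgroup_def m_inv_def)
  moreover have "a \<otimes> x \<in> I" if "a \<in> I" "x \<in> carrier R" for a x
    using closed that by (metis m_comm subsetD)
  ultimately show "ideal I R"
    using closed(2) by (intro idealI[OF ring_axioms])
next
  assume "ideal I R"
  then interpret ideal I R .
  show "submodule I R (regular_module R)"
    by (rule module.submoduleI_smult[OF module_regular_module]) (auto simp: a_subset I_l_closed)
qed

lemma submodule_gen_regular_module:
  "cring R \<Longrightarrow> submodule_gen R (regular_module R) G = Idl\<^bsub>R\<^esub> G"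
  by (simp add: submodule_gen_def genideal_def cring.submodule_regular_module_iff_ideal)

lemma image_submodule_gen_ideal:
  assumes "module R M" "mod_hom R M (regular_module R) \<phi>" "G \<subseteq> carrier M"
  shows "\<phi> ` submodule_gen R M G = Idl\<^bsub>R\<^esub> (\<phi> ` G)"
proof -
  interpret module R M by fact
  show ?thesis
    using image_submodule_gen[OF assms(1) module_regular_module assms(2,3)]
    by (simp add: submodule_gen_regular_module is_cring)
qed

definition prod_module :: "('a,'b) module \<Rightarrow> ('a,'d) module \<Rightarrow> ('a,'b \<times> 'd) module" where
  "prod_module M N =
     \<lparr>carrier = carrier M \<times> carrier N,
      mult = (\<lambda>x y. (\<zero>\<^bsub>M\<^esub>, \<zero>\<^bsub>N\<^esub>)),
      one = (\<zero>\<^bsub>M\<^esub>, \<zero>\<^bsub>N\<^esub>),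
      zero = (\<zero>\<^bsub>M\<^esub>, \<zero>\<^bsub>N\<^esub>),
      add = (\<lambda>x y. (fst x \<oplus>\<^bsub>M\<^esub> fst y, snd x \<oplus>\<^bsub>N\<^esub> snd y)),
      smult = (\<lambda>r x. (r \<odot>\<^bsub>M\<^esub> fst x, r \<odot>\<^bsub>N\<^esub> snd x))\<rparr>"

lemma prod_module_simps [simp]:
  "carrier (prod_module M N) = carrier M \<times> carrier N"
  "\<zero>\<^bsub>prod_module M N\<^esub> = (\<zero>\<^bsub>M\<^esub>, \<zero>\<^bsub>N\<^esub>)"
  "x \<oplus>\<^bsub>prod_module M N\<^esub> y = (fst x \<oplus>\<^bsub>M\<^esub> fst y, snd x \<oplus>\<^bsub>N\<^esub> snd y)"
  "r \<odot>\<^bsub>prod_module M N\<^esub> x = (r \<odot>\<^bsub>M\<^esub> fst x, r \<odot>\<^bsub>N\<^esub> snd x)"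
  by (simp_all add: prod_module_def)

lemma mod_hom_fst: "mod_hom R (prod_module M N) M fst"
  by (rule mod_homI) auto

lemma mod_hom_snd: "mod_hom R (prod_module M N) N snd"
  by (rule mod_homI) auto

context
  fixes R :: "'a ring" and M :: "('a,'b) module" and N :: "('a,'d) module"
  assumes M: "module R M" and N: "module R N"
begin

interpretation M: module R M by (rule M)
interpretation N: module R N by (rule N)

lemma module_prod_module: "module R (prod_module M N)"
proof (rule moduleI[OF M.is_cring abelian_groupI])
  fix x assume "x \<in> carrier (prod_module M N)"
  then show "\<exists>y\<in>carrier (prod_module M N). y \<oplus>\<^bsub>prod_module M N\<^esub> x = \<zero>\<^bsub>prod_module M N\<^esub>"
    by (intro bexI[of _ "(\<ominus>\<^bsub>M\<^esub> fst x, \<ominus>\<^bsub>N\<^esub> snd x)"]) (auto simp: M.M.l_neg N.M.l_neg)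
qed (auto simp: M.M.a_ac M.smult_l_distr M.smult_r_distr M.smult_assoc1
    N.M.a_ac N.smult_l_distr N.smult_r_distr N.smult_assoc1)

lemma minus_prod_module:
  assumes "x \<in> carrier (prod_module M N)" "y \<in> carrier (prod_module M N)"
  shows "x \<ominus>\<^bsub>prod_module M N\<^esub> y = (fst x \<ominus>\<^bsub>M\<^esub> fst y, snd x \<ominus>\<^bsub>N\<^esub> snd y)"
  using mod_hom_minus[OF module_prod_module M mod_hom_fst assms]
    mod_hom_minus[OF module_prod_module N mod_hom_snd assms]
  by (simp add: prod_eq_iff)

lemma mod_hom_inl: "mod_hom R M (prod_module M N) (\<lambda>x. (x, \<zero>\<^bsub>N\<^esub>))"
  by (rule mod_homI) auto

lemma mod_hom_inr: "mod_hom R N (prod_module M N) (\<lambda>y. (\<zero>\<^bsub>M\<^esub>, y))"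
  by (rule mod_homI) auto

end

text \<open>If the fibres of $q$ are the cosets of a submodule $W$, this is $M/W$, realised on the set
  $q(M)$.\<close>
definition image_module :: "('a,'b) module \<Rightarrow> ('b \<Rightarrow> 'd) \<Rightarrow> ('a,'d) module" where
  "image_module M q =
     \<lparr>carrier = q ` carrier M,
      mult = (\<lambda>X Y. q \<zero>\<^bsub>M\<^esub>),
      one = q \<zero>\<^bsub>M\<^esub>,
      zero = q \<zero>\<^bsub>M\<^esub>,
      add = (\<lambda>X Y. q (inv_into (carrier M) q X \<oplus>\<^bsub>M\<^esub> inv_into (carrier M) q Y)),
      smult = (\<lambda>r X. q (r \<odot>\<^bsub>M\<^esub> inv_into (carrier M) q X))\<rparr>"

context
  fixes R :: "'a ring" and M :: "('a,'b) module" and W and q :: "'b \<Rightarrow> 'd"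
  assumes M: "module R M" and W: "submodule W R M"
    and fibres: "\<And>x y. x \<in> carrier M \<Longrightarrow> y \<in> carrier M \<Longrightarrow> q x = q y \<longleftrightarrow> x \<ominus>\<^bsub>M\<^esub> y \<in> W"
begin

interpretation M: module R M by (rule M)

lemma mod_hom_image_module: "mod_hom R M (image_module M q) q"
proof (rule mod_homI)
  have fibre_repr: "inv_into (carrier M) q (q x) \<in> carrier M"
    "x \<ominus>\<^bsub>M\<^esub> inv_into (carrier M) q (q x) \<in> W"
    if "x \<in> carrier M" for x
  proof -
    show closed: "inv_into (carrier M) q (q x) \<in> carrier M"
      using that by (auto intro: inv_into_into)
    show "x \<ominus>\<^bsub>M\<^esub> inv_into (carrier M) q (q x) \<in> W"
      using fibres[OF that closed] that by (simp add: f_inv_into_f)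
  qed
  show "q (x \<oplus>\<^bsub>M\<^esub> y) = q x \<oplus>\<^bsub>image_module M q\<^esub> q y" if "x \<in> carrier M" "y \<in> carrier M" for x y
  proof -
    define x' y' where "x' = inv_into (carrier M) q (q x)" and "y' = inv_into (carrier M) q (q y)"
    have closed: "x' \<in> carrier M" "y' \<in> carrier M" and W_mem: "x \<ominus>\<^bsub>M\<^esub> x' \<in> W" "y \<ominus>\<^bsub>M\<^esub> y' \<in> W"
      using fibre_repr that by (auto simp: x'_def y'_def)
    have "(x \<oplus>\<^bsub>M\<^esub> y) \<ominus>\<^bsub>M\<^esub> (x' \<oplus>\<^bsub>M\<^esub> y') = (x \<ominus>\<^bsub>M\<^esub> x') \<oplus>\<^bsub>M\<^esub> (y \<ominus>\<^bsub>M\<^esub> y')"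
      using that closed by (simp add: a_minus_def M.M.minus_add M.M.a_ac)
    also have "\<dots> \<in> W" by (rule M.submoduleE(5)[OF W W_mem])
    finally have "q (x \<oplus>\<^bsub>M\<^esub> y) = q (x' \<oplus>\<^bsub>M\<^esub> y')" using that closed by (subst fibres) auto
    then show ?thesis by (simp add: image_module_def x'_def y'_def)
  qed
  show "q (r \<odot>\<^bsub>M\<^esub> x) = r \<odot>\<^bsub>image_module M q\<^esub> q x" if "r \<in> carrier R" "x \<in> carrier M" for r x
  proof -
    define x' where "x' = inv_into (carrier M) q (q x)"
    have closed: "x' \<in> carrier M" and W_mem: "x \<ominus>\<^bsub>M\<^esub> x' \<in> W"
      using fibre_repr that by (auto simp: x'_def)
    have "r \<odot>\<^bsub>M\<^esub> x \<ominus>\<^bsub>M\<^esub> r \<odot>\<^bsub>M\<^esub> x' = r \<odot>\<^bsub>M\<^esub> (x \<ominus>\<^bsub>M\<^esub> x')"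
      using that closed by (simp add: a_minus_def M.smult_r_distr M.smult_r_minus)
    also have "\<dots> \<in> W" by (rule M.submoduleE(4)[OF W that(1) W_mem])
    finally have "q (r \<odot>\<^bsub>M\<^esub> x) = q (r \<odot>\<^bsub>M\<^esub> x')" using that closed by (subst fibres) auto
    then show ?thesis by (simp add: image_module_def x'_def)
  qed
qed (simp add: image_module_def)

lemma module_image_module: "module R (image_module M q)"
  by (rule module_surj_image[OF M mod_hom_image_module]) (simp_all add: image_module_def)

end

section \<open>Pushouts and extension of linear maps\<close>

locale module_pushout =
  fixes R :: "'a ring" and M :: "('a,'m) module" and A :: "('a,'x) module"
    and C :: "('a,'c) module" and p :: "'m \<Rightarrow> 'x" and h :: "'m \<Rightarrow> 'c"
  assumes M: "module R M" and A: "module R A" and C: "module R C"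
    and p: "mod_hom R M A p" and p_surj: "p ` carrier M = carrier A"
    and h: "mod_hom R (M\<lparr>carrier := {x \<in> carrier M. p x = \<zero>\<^bsub>A\<^esub>}\<rparr>) C h"
begin

sublocale M: module R M by (rule M)
sublocale A: module R A by (rule A)
sublocale C: module R C by (rule C)

definition ker :: "'m set" where
  "ker = {x \<in> carrier M. p x = \<zero>\<^bsub>A\<^esub>}"

lemma submodule_ker: "submodule ker R M"
  unfolding ker_def by (rule submodule_kernel[OF M A p])

lemma module_ker: "module R (M\<lparr>carrier := ker\<rparr>)"
  by (rule submodule.submodule_is_module[OF submodule_ker M])

lemmas ker_closed = M.submoduleE(4,5)[OF submodule_ker]

lemma ker_carrier: "x \<in> ker \<Longrightarrow> x \<in> carrier M"
  by (simp add: ker_def)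

lemma h_closed: "x \<in> ker \<Longrightarrow> h x \<in> carrier C"
  using mod_hom_closed[OF h] by (simp add: ker_def)

lemma h_zero: "h \<zero>\<^bsub>M\<^esub> = \<zero>\<^bsub>C\<^esub>"
  using mod_hom_zero[OF module_ker[unfolded ker_def] C h] by simp

lemma h_add: "x \<in> ker \<Longrightarrow> y \<in> ker \<Longrightarrow> h (x \<oplus>\<^bsub>M\<^esub> y) = h x \<oplus>\<^bsub>C\<^esub> h y"
  using mod_hom_add[OF h] by (simp add: ker_def)

lemma h_smult: "r \<in> carrier R \<Longrightarrow> x \<in> ker \<Longrightarrow> h (r \<odot>\<^bsub>M\<^esub> x) = r \<odot>\<^bsub>C\<^esub> h x"
  using mod_hom_smult[OF h] by (simp add: ker_def)

lemma p_eq_iff: "x \<in> carrier M \<Longrightarrow> y \<in> carrier M \<Longrightarrow> p x = p y \<longleftrightarrow> x \<ominus>\<^bsub>M\<^esub> y \<in> ker"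
  by (simp add: ker_def mod_hom_eq_iff[OF M A p])

text \<open>The fibres of this map on $C \times M$ are the cosets of $\{(-h(n), n) \mid n \in \ker p\}$,
  so its image is the pushout of $h$ and the inclusion of $\ker p$; a set-theoretic section of $p$
  places it on $C \times A$, where \<^const>\<open>ext1_vanishes\<close> looks for extensions.\<close>
definition glue :: "'c \<times> 'm \<Rightarrow> 'c \<times> 'x" where
  "glue = (\<lambda>(c, x). (c \<oplus>\<^bsub>C\<^esub> h (x \<ominus>\<^bsub>M\<^esub> inv_into (carrier M) p (p x)), p x))"

lemma glue_eq_iff:
  assumes "c \<in> carrier C" "c' \<in> carrier C" "x \<in> carrier M" "y \<in> carrier M"
  shows "glue (c, x) = glue (c', y) \<longleftrightarrow> x \<ominus>\<^bsub>M\<^esub> y \<in> ker \<and> c \<oplus>\<^bsub>C\<^esub> h (x \<ominus>\<^bsub>M\<^esub> y) = c'"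
proof (cases "p x = p y")
  case False
  then show ?thesis using p_eq_iff assms by (simp add: glue_def)
next
  case True
  define z where "z = inv_into (carrier M) p (p y)"
  have z: "z \<in> carrier M" "p z = p y"
    unfolding z_def using assms by (auto intro: inv_into_into f_inv_into_f)
  have ker_mem: "x \<ominus>\<^bsub>M\<^esub> y \<in> ker" "y \<ominus>\<^bsub>M\<^esub> z \<in> ker"
    using p_eq_iff[of x y] p_eq_iff[of y z] True z assms by auto
  have "x \<ominus>\<^bsub>M\<^esub> z = (x \<ominus>\<^bsub>M\<^esub> y) \<oplus>\<^bsub>M\<^esub> (y \<ominus>\<^bsub>M\<^esub> z)"
    using assms z by (simp add: a_minus_def M.M.a_assoc M.M.r_neg1)
  then have "c \<oplus>\<^bsub>C\<^esub> h (x \<ominus>\<^bsub>M\<^esub> z) = (c \<oplus>\<^bsub>C\<^esub> h (x \<ominus>\<^bsub>M\<^esub> y)) \<oplus>\<^bsub>C\<^esub> h (y \<ominus>\<^bsub>M\<^esub> z)"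
    using assms by (simp add: h_add ker_mem h_closed C.M.a_assoc)
  then show ?thesis using True assms ker_mem h_closed by (simp add: glue_def z_def)
qed

definition antidiagonal :: "('c \<times> 'm) set" where
  "antidiagonal = {z \<in> carrier C \<times> ker. fst z \<oplus>\<^bsub>C\<^esub> h (snd z) = \<zero>\<^bsub>C\<^esub>}"

lemma submodule_antidiagonal: "submodule antidiagonal R (prod_module C M)"
proof (rule module.submoduleI_smult[OF module_prod_module[OF C M]])
  show "z \<oplus>\<^bsub>prod_module C M\<^esub> w \<in> antidiagonal" if "z \<in> antidiagonal" "w \<in> antidiagonal" for z w
  proof -
    have closed: "fst z \<in> carrier C" "fst w \<in> carrier C" "snd z \<in> ker" "snd w \<in> ker"
      and zero: "fst z \<oplus>\<^bsub>C\<^esub> h (snd z) = \<zero>\<^bsub>C\<^esub>" "fst w \<oplus>\<^bsub>C\<^esub> h (snd w) = \<zero>\<^bsub>C\<^esub>"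
      using that by (auto simp: antidiagonal_def)
    have "(fst z \<oplus>\<^bsub>C\<^esub> fst w) \<oplus>\<^bsub>C\<^esub> h (snd z \<oplus>\<^bsub>M\<^esub> snd w)
        = (fst z \<oplus>\<^bsub>C\<^esub> h (snd z)) \<oplus>\<^bsub>C\<^esub> (fst w \<oplus>\<^bsub>C\<^esub> h (snd w))"
      using closed by (simp add: h_add h_closed C.M.a_ac)
    then show ?thesis using closed zero ker_closed by (simp add: antidiagonal_def)
  qed
  show "r \<odot>\<^bsub>prod_module C M\<^esub> z \<in> antidiagonal" if "r \<in> carrier R" "z \<in> antidiagonal" for r z
  proof -
    have closed: "fst z \<in> carrier C" "snd z \<in> ker" and zero: "fst z \<oplus>\<^bsub>C\<^esub> h (snd z) = \<zero>\<^bsub>C\<^esub>"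
      using that by (auto simp: antidiagonal_def)
    have "r \<odot>\<^bsub>C\<^esub> fst z \<oplus>\<^bsub>C\<^esub> h (r \<odot>\<^bsub>M\<^esub> snd z) = r \<odot>\<^bsub>C\<^esub> (fst z \<oplus>\<^bsub>C\<^esub> h (snd z))"
      using that(1) closed by (simp add: h_smult h_closed C.smult_r_distr)
    then show ?thesis using that(1) closed zero ker_closed by (simp add: antidiagonal_def)
  qed
qed (auto simp: antidiagonal_def ker_carrier h_zero M.submodule_zero_closed[OF submodule_ker])

lemma glue_fibres:
  assumes "z \<in> carrier (prod_module C M)" "w \<in> carrier (prod_module C M)"
  shows "glue z = glue w \<longleftrightarrow> z \<ominus>\<^bsub>prod_module C M\<^esub> w \<in> antidiagonal"
proof -
  obtain c x c' y where [simp]: "z = (c, x)" "w = (c', y)" by fastforce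
  have closed: "c \<in> carrier C" "c' \<in> carrier C" "x \<in> carrier M" "y \<in> carrier M" using assms by auto
  have "(c \<ominus>\<^bsub>C\<^esub> c') \<oplus>\<^bsub>C\<^esub> d = (c \<oplus>\<^bsub>C\<^esub> d) \<ominus>\<^bsub>C\<^esub> c'" if "d \<in> carrier C" for d
    using closed that by (simp add: a_minus_def C.M.a_ac)
  then show ?thesis
    using closed h_closed
    by (auto simp: glue_eq_iff antidiagonal_def minus_prod_module[OF C M] C.M.minus_eq_zero_iff)
qed

definition pushout :: "('a, 'c \<times> 'x) module" where
  "pushout = image_module (prod_module C M) glue"

lemma module_pushout: "module R pushout"
  unfolding pushout_def
  by (rule module_image_module[OF module_prod_module[OF C M] submodule_antidiagonal glue_fibres])

lemma mod_hom_glue: "mod_hom R (prod_module C M) pushout glue"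
  unfolding pushout_def
  by (rule mod_hom_image_module[OF module_prod_module[OF C M] submodule_antidiagonal glue_fibres])

lemma carrier_pushout: "carrier pushout = glue ` (carrier C \<times> carrier M)"
  by (simp add: pushout_def image_module_def)

lemma mod_hom_pushout_inl: "mod_hom R C pushout (\<lambda>c. glue (c, \<zero>\<^bsub>M\<^esub>))"
  by (rule mod_hom_comp[OF mod_hom_inl[OF C M] mod_hom_glue])

lemma mod_hom_pushout_inr: "mod_hom R M pushout (\<lambda>x. glue (\<zero>\<^bsub>C\<^esub>, x))"
  by (rule mod_hom_comp[OF mod_hom_inr[OF C M] mod_hom_glue])

lemma inj_pushout_inl: "inj_on (\<lambda>c. glue (c, \<zero>\<^bsub>M\<^esub>)) (carrier C)"
  by (rule inj_onI) (auto simp: glue_eq_iff h_zero M.M.minus_zero_right)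

lemma pushout_inr_eq_inl: "x \<in> ker \<Longrightarrow> glue (\<zero>\<^bsub>C\<^esub>, x) = glue (h x, \<zero>\<^bsub>M\<^esub>)"
  by (simp add: glue_eq_iff h_closed ker_carrier M.M.minus_zero_right)

lemma snd_glue: "snd (glue z) = p (snd z)"
  by (simp add: glue_def split: prod.split)

lemma mod_hom_pushout_snd: "mod_hom R pushout A snd"
proof (rule mod_homI)
  show "snd X \<in> carrier A" if "X \<in> carrier pushout" for X
    using that mod_hom_closed[OF p] by (auto simp: carrier_pushout snd_glue)
  show "snd (X \<oplus>\<^bsub>pushout\<^esub> Y) = snd X \<oplus>\<^bsub>A\<^esub> snd Y"
    if "X \<in> carrier pushout" "Y \<in> carrier pushout" for X Y
    using that mod_hom_add[OF p]
    by (auto simp: carrier_pushout snd_glue mod_hom_add[OF mod_hom_glue, symmetric])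
  show "snd (r \<odot>\<^bsub>pushout\<^esub> X) = r \<odot>\<^bsub>A\<^esub> snd X" if "r \<in> carrier R" "X \<in> carrier pushout" for r X
    using that mod_hom_smult[OF p]
    by (auto simp: carrier_pushout snd_glue mod_hom_smult[OF mod_hom_glue, symmetric])
qed

lemma pushout_snd_surj: "snd ` carrier pushout = carrier A"
  by (force simp: carrier_pushout image_image snd_glue p_surj[symmetric])

lemma pushout_kernel:
  "(\<lambda>c. glue (c, \<zero>\<^bsub>M\<^esub>)) ` carrier C = {b \<in> carrier pushout. snd b = \<zero>\<^bsub>A\<^esub>}"
proof (intro equalityI subsetI)
  fix b assume "b \<in> (\<lambda>c. glue (c, \<zero>\<^bsub>M\<^esub>)) ` carrier C"
  then show "b \<in> {b \<in> carrier pushout. snd b = \<zero>\<^bsub>A\<^esub>}"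
    by (auto simp: carrier_pushout snd_glue mod_hom_zero[OF M A p])
next
  fix b assume "b \<in> {b \<in> carrier pushout. snd b = \<zero>\<^bsub>A\<^esub>}"
  then obtain c x where b: "c \<in> carrier C" "x \<in> ker" "b = glue (c, x)"
    by (auto simp: carrier_pushout snd_glue ker_def)
  then have "b = glue (c \<oplus>\<^bsub>C\<^esub> h x, \<zero>\<^bsub>M\<^esub>)"
    by (simp add: glue_eq_iff h_closed ker_carrier M.M.minus_zero_right)
  then show "b \<in> (\<lambda>c. glue (c, \<zero>\<^bsub>M\<^esub>)) ` carrier C" using b h_closed by auto
qed

end

lemma ext1_vanishes_extend:
  assumes ext: "ext1_vanishes R A C"
    and M: "module R M" and A: "module R A" and C: "module R C"
    and p: "mod_hom R M A p" and p_surj: "p ` carrier M = carrier A"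
    and h: "mod_hom R (M\<lparr>carrier := {x \<in> carrier M. p x = \<zero>\<^bsub>A\<^esub>}\<rparr>) C h"
  obtains H where "mod_hom R M C H" "\<And>x. x \<in> carrier M \<Longrightarrow> p x = \<zero>\<^bsub>A\<^esub> \<Longrightarrow> H x = h x"
proof -
  interpret module_pushout R M A C p h
    by (rule module_pushout.intro[OF M A C p p_surj h])
  interpret pushout: module R pushout by (rule module_pushout)
  obtain s where s: "mod_hom R A pushout s" and snd_s: "\<And>a. a \<in> carrier A \<Longrightarrow> snd (s a) = a"
    using ext module_pushout mod_hom_pushout_inl mod_hom_pushout_snd inj_pushout_inl
      pushout_snd_surj pushout_kernel
    unfolding ext1_vanishes_def by blast
  define \<sigma> where "\<sigma> = (\<lambda>x. glue (\<zero>\<^bsub>C\<^esub>, x) \<ominus>\<^bsub>pushout\<^esub> s (p x))"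
  have \<sigma>: "mod_hom R M pushout \<sigma>"
    unfolding \<sigma>_def
    by (rule mod_hom_diff[OF module_pushout mod_hom_pushout_inr mod_hom_comp[OF p s]])
  have "snd (\<sigma> x) = \<zero>\<^bsub>A\<^esub>" if "x \<in> carrier M" for x
    unfolding \<sigma>_def using that mod_hom_closed[OF mod_hom_pushout_inr] mod_hom_closed[OF s]
      mod_hom_closed[OF p]
    by (simp add: mod_hom_minus[OF module_pushout A mod_hom_pushout_snd] snd_s snd_glue
        A.M.minus_eq_zero_iff)
  then have "\<sigma> ` carrier M \<subseteq> (\<lambda>c. glue (c, \<zero>\<^bsub>M\<^esub>)) ` carrier C"
    using mod_hom_closed[OF \<sigma>] by (auto simp: pushout_kernel)
  then obtain H where H: "mod_hom R M C H" "\<And>x. x \<in> carrier M \<Longrightarrow> glue (H x, \<zero>\<^bsub>M\<^esub>) = \<sigma> x"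
    using mod_hom_factor_inj[OF M C mod_hom_pushout_inl inj_pushout_inl \<sigma>] by blast
  have "H x = h x" if x: "x \<in> carrier M" "p x = \<zero>\<^bsub>A\<^esub>" for x
  proof (rule inj_onD[OF inj_pushout_inl])
    show "glue (H x, \<zero>\<^bsub>M\<^esub>) = glue (h x, \<zero>\<^bsub>M\<^esub>)"
      using x H(2)[OF x(1)] mod_hom_closed[OF mod_hom_pushout_inr x(1)]
      by (simp add: \<sigma>_def mod_hom_zero[OF A module_pushout s] pushout_inr_eq_inl ker_def
          pushout.M.minus_zero_right)
  qed (use x h_closed mod_hom_closed[OF H(1)] in \<open>auto simp: ker_def\<close>)
  with H(1) show thesis by (rule that)
qed

section \<open>Localizations\<close>

inductive_set mult_gen :: "('a,'k) ring_scheme \<Rightarrow> 'a set \<Rightarrow> 'a set" for R A where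
  one: "\<one>\<^bsub>R\<^esub> \<in> mult_gen R A"
| mult: "a \<in> A \<Longrightarrow> s \<in> mult_gen R A \<Longrightarrow> a \<otimes>\<^bsub>R\<^esub> s \<in> mult_gen R A"

lemma countable_mult_gen:
  assumes "countable A"
  shows "countable (mult_gen R A)"
proof (rule countable_subset)
  show "mult_gen R A \<subseteq> (\<lambda>as. foldr (mult R) as \<one>\<^bsub>R\<^esub>) ` lists A"
  proof
    fix s assume "s \<in> mult_gen R A"
    then show "s \<in> (\<lambda>as. foldr (mult R) as \<one>\<^bsub>R\<^esub>) ` lists A"
    proof induction
      case one
      show ?case by (rule image_eqI[of _ _ "[]"]) auto
    next
      case (mult a s)
      then obtain as where "as \<in> lists A" "s = foldr (mult R) as \<one>\<^bsub>R\<^esub>" by blast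
      with mult(1) show ?case by (intro image_eqI[of _ _ "a # as"]) auto
    qed
  qed
  show "countable ((\<lambda>as. foldr (mult R) as \<one>\<^bsub>R\<^esub>) ` lists A)" using assms by simp
qed

lemma mult_subset_mult_gen:
  fixes R :: "'a ring" (structure)
  assumes "cring R" "A \<subseteq> carrier R"
  shows "mult_subset R (mult_gen R A)"
proof -
  interpret cring R by fact
  have closed: "s \<in> carrier R" if "s \<in> mult_gen R A" for s
    using that by induction (use assms in auto)
  have "s \<otimes> t \<in> mult_gen R A" if "s \<in> mult_gen R A" "t \<in> mult_gen R A" for s t
    using that(1)
  proof induction
    case one
    then show ?case using that(2) closed by simp
  next
    case (mult a s)
    then have "(a \<otimes> s) \<otimes> t = a \<otimes> (s \<otimes> t)"
      using assms closed that(2) by (simp add: m_assoc subset_iff)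
    then show ?case using mult.hyps(1) mult.IH by (simp add: mult_gen.mult)
  qed
  then show ?thesis using closed mult_gen.one by (auto simp: mult_subset_def)
qed

lemma (in cring) mult_gen_complement:
  assumes "ideal I R" "A \<subseteq> I" "s \<in> mult_gen R ((\<lambda>a. \<one> \<ominus> a) ` A)"
  shows "\<one> \<ominus> s \<in> I"
proof -
  interpret ideal I R by fact
  have "s \<in> carrier R \<and> \<one> \<ominus> s \<in> I"
    using assms(3)
  proof induction
    case one
    show ?case using additive_subgroup.zero_closed[OF is_additive_subgroup]
      by (simp add: a_minus_def r_neg)
  next
    case (mult c s)
    then obtain a where a: "a \<in> I" "c = \<one> \<ominus> a" using assms(2) by blast
    have closed: "a \<in> carrier R" "s \<in> carrier R" using a(1) a_Hcarr mult.IH by auto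
    have "\<one> \<ominus> c \<otimes> s = (\<one> \<ominus> s) \<oplus> a \<otimes> s" unfolding a(2) using closed by algebra
    also have "\<dots> \<in> I" using a(1) closed(2) mult.IH I_r_closed by simp
    finally show ?case using a(2) closed by simp
  qed
  then show ?thesis ..
qed

locale localization = cring R for R :: "'a ring" (structure) +
  fixes S
  assumes mult_subset: "mult_subset R S"
begin

lemma S_closed: "s \<in> S \<Longrightarrow> s \<in> carrier R" "\<one> \<in> S" "s \<in> S \<Longrightarrow> t \<in> S \<Longrightarrow> s \<otimes> t \<in> S"
  using mult_subset by (auto simp: mult_subset_def)

definition fraction :: "'a \<Rightarrow> 'a \<Rightarrow> ('a \<times> 'a) set" where
  "fraction r s = loc_rel R S `` {(r, s)}"

lemma equiv_loc_rel: "equiv (carrier R \<times> S) (loc_rel R S)"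
proof (rule equivI)
  show "loc_rel R S \<subseteq> (carrier R \<times> S) \<times> (carrier R \<times> S)" by (auto simp: loc_rel_def)
  have "\<exists>t\<in>S. t \<otimes> (r \<otimes> s \<ominus> r \<otimes> s) = \<zero>" if "r \<in> carrier R" "s \<in> S" for r s
    using that S_closed by (intro bexI[of _ \<one>]) (auto simp: a_minus_def r_neg)
  then show "refl_on (carrier R \<times> S) (loc_rel R S)"
    by (auto simp: refl_on_def loc_rel_def)
  show "sym (loc_rel R S)"
  proof (rule symI, clarify)
    fix r s r' s' assume rel: "((r, s), (r', s')) \<in> loc_rel R S"
    then obtain t where t: "t \<in> S" "t \<otimes> (r \<otimes> s' \<ominus> r' \<otimes> s) = \<zero>" by (auto simp: loc_rel_def)
    have "t \<otimes> (r' \<otimes> s \<ominus> r \<otimes> s') = \<ominus> (t \<otimes> (r \<otimes> s' \<ominus> r' \<otimes> s))"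
      using rel t(1) S_closed(1) by (auto simp: loc_rel_def) algebra
    then show "((r', s'), (r, s)) \<in> loc_rel R S" using rel t by (auto simp: loc_rel_def)
  qed
  show "trans (loc_rel R S)"
  proof (rule transI, clarify)
    fix r s r' s' r'' s''
    assume rel: "((r, s), (r', s')) \<in> loc_rel R S" "((r', s'), (r'', s'')) \<in> loc_rel R S"
    obtain t u where t: "t \<in> S" "t \<otimes> (r \<otimes> s' \<ominus> r' \<otimes> s) = \<zero>"
      and u: "u \<in> S" "u \<otimes> (r' \<otimes> s'' \<ominus> r'' \<otimes> s') = \<zero>"
      using rel by (auto simp: loc_rel_def)
    have closed: "r \<in> carrier R" "s \<in> carrier R" "r' \<in> carrier R" "s' \<in> carrier R"
      "r'' \<in> carrier R" "s'' \<in> carrier R" "t \<in> carrier R" "u \<in> carrier R"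
      using rel t u S_closed by (auto simp: loc_rel_def)
    have "(t \<otimes> u \<otimes> s') \<otimes> (r \<otimes> s'' \<ominus> r'' \<otimes> s)
      = u \<otimes> s'' \<otimes> (t \<otimes> (r \<otimes> s' \<ominus> r' \<otimes> s)) \<oplus> t \<otimes> s \<otimes> (u \<otimes> (r' \<otimes> s'' \<ominus> r'' \<otimes> s'))"
      using closed by algebra
    also have "\<dots> = \<zero>" unfolding t(2) u(2) using closed by simp
    finally show "((r, s), (r'', s'')) \<in> loc_rel R S"
      using rel t u S_closed(3) by (auto simp: loc_rel_def intro!: bexI[of _ "t \<otimes> u \<otimes> s'"])
  qed
qed

lemma fraction_eq_iff:
  assumes "r \<in> carrier R" "s \<in> S" "r' \<in> carrier R" "s' \<in> S"
  shows "fraction r s = fraction r' s' \<longleftrightarrow> (\<exists>t\<in>S. t \<otimes> (r \<otimes> s' \<ominus> r' \<otimes> s) = \<zero>)"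
  unfolding fraction_def using assms
  by (subst eq_equiv_class_iff[OF equiv_loc_rel]) (auto simp: loc_rel_def)

lemma rep_fraction:
  assumes "r \<in> carrier R" "s \<in> S"
  obtains r' s' where "rep (fraction r s) = (r', s')" "r' \<in> carrier R" "s' \<in> S"
    "fraction r' s' = fraction r s"
proof -
  have "(r, s) \<in> fraction r s"
    unfolding fraction_def using assms by (intro equiv_class_self[OF equiv_loc_rel]) auto
  then have "rep (fraction r s) \<in> fraction r s" unfolding rep_def by (rule someI)
  then have rel: "((r, s), rep (fraction r s)) \<in> loc_rel R S" by (simp add: fraction_def)
  obtain r' s' where rep: "rep (fraction r s) = (r', s')" by fastforce
  have "fraction r s = fraction r' s'"
    unfolding fraction_def using rel unfolding rep by (rule equiv_class_eq[OF equiv_loc_rel])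
  then show thesis using that rel unfolding rep by (auto simp: loc_rel_def)
qed

lemma carrier_loc_module: "carrier (loc_module R S) = {fraction r s | r s. r \<in> carrier R \<and> s \<in> S}"
  by (auto simp: loc_module_def fraction_def quotient_def)

lemma zero_loc_module: "\<zero>\<^bsub>loc_module R S\<^esub> = fraction \<zero> \<one>"
  by (simp add: loc_module_def fraction_def)

lemma add_fraction:
  assumes "r \<in> carrier R" "s \<in> S" "r' \<in> carrier R" "s' \<in> S"
  shows "fraction r s \<oplus>\<^bsub>loc_module R S\<^esub> fraction r' s' = fraction (r \<otimes> s' \<oplus> r' \<otimes> s) (s \<otimes> s')"
proof -
  obtain x u where x: "rep (fraction r s) = (x, u)" "x \<in> carrier R" "u \<in> S"
    "fraction x u = fraction r s"
    using rep_fraction assms(1,2) by metis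
  obtain y v where y: "rep (fraction r' s') = (y, v)" "y \<in> carrier R" "v \<in> S"
    "fraction y v = fraction r' s'"
    using rep_fraction assms(3,4) by metis
  obtain t where t: "t \<in> S" "t \<otimes> (x \<otimes> s \<ominus> r \<otimes> u) = \<zero>"
    using x assms by (auto simp: fraction_eq_iff)
  obtain t' where t': "t' \<in> S" "t' \<otimes> (y \<otimes> s' \<ominus> r' \<otimes> v) = \<zero>"
    using y assms by (auto simp: fraction_eq_iff)
  have S_carrier: "s \<in> carrier R" "s' \<in> carrier R" "u \<in> carrier R" "v \<in> carrier R"
    "t \<in> carrier R" "t' \<in> carrier R"
    using assms x y t t' S_closed by auto
  have "(t \<otimes> t') \<otimes> ((x \<otimes> v \<oplus> y \<otimes> u) \<otimes> (s \<otimes> s') \<ominus> (r \<otimes> s' \<oplus> r' \<otimes> s) \<otimes> (u \<otimes> v))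
      = (t' \<otimes> s' \<otimes> v) \<otimes> (t \<otimes> (x \<otimes> s \<ominus> r \<otimes> u)) \<oplus> (t \<otimes> s \<otimes> u) \<otimes> (t' \<otimes> (y \<otimes> s' \<ominus> r' \<otimes> v))"
    using S_carrier assms(1,3) x(2) y(2) by algebra
  also have "\<dots> = \<zero>" unfolding t(2) t'(2) using S_carrier by simp
  finally have "fraction (x \<otimes> v \<oplus> y \<otimes> u) (u \<otimes> v) = fraction (r \<otimes> s' \<oplus> r' \<otimes> s) (s \<otimes> s')"
    using assms x y t t' S_carrier S_closed(3) by (subst fraction_eq_iff) auto
  then show ?thesis using x(1) y(1) by (simp add: loc_module_def fraction_def)
qed

lemma smult_fraction:
  assumes "a \<in> carrier R" "r \<in> carrier R" "s \<in> S"
  shows "a \<odot>\<^bsub>loc_module R S\<^esub> fraction r s = fraction (a \<otimes> r) s"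
proof -
  obtain x u where x: "rep (fraction r s) = (x, u)" "x \<in> carrier R" "u \<in> S"
    "fraction x u = fraction r s"
    using rep_fraction assms(2,3) by metis
  obtain t where t: "t \<in> S" "t \<otimes> (x \<otimes> s \<ominus> r \<otimes> u) = \<zero>"
    using x assms by (auto simp: fraction_eq_iff)
  have S_carrier: "s \<in> carrier R" "u \<in> carrier R" "t \<in> carrier R"
    using assms x t S_closed by auto
  have "t \<otimes> ((a \<otimes> x) \<otimes> s \<ominus> (a \<otimes> r) \<otimes> u) = a \<otimes> (t \<otimes> (x \<otimes> s \<ominus> r \<otimes> u))"
    using S_carrier assms(1,2) x(2) by algebra
  also have "\<dots> = \<zero>" unfolding t(2) using assms(1) by simp
  finally have "fraction (a \<otimes> x) u = fraction (a \<otimes> r) s"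
    using assms x t by (subst fraction_eq_iff) auto
  then show ?thesis using x(1) by (simp add: loc_module_def fraction_def)
qed

lemma mod_hom_localization: "mod_hom R (regular_module R) (loc_module R S) (\<lambda>r. fraction r \<one>)"
proof (rule mod_homI)
  show "fraction r \<one> \<in> carrier (loc_module R S)" if "r \<in> carrier (regular_module R)" for r
    using that S_closed(2) by (auto simp: carrier_loc_module)
qed (auto simp: add_fraction smult_fraction S_closed(2))

lemma localization_kernel:
  "r \<in> carrier R \<Longrightarrow> fraction r \<one> = \<zero>\<^bsub>loc_module R S\<^esub> \<longleftrightarrow> (\<exists>s\<in>S. s \<otimes> r = \<zero>)"
  by (simp add: zero_loc_module fraction_eq_iff S_closed(2) a_minus_def)

lemma ideal_localization_kernel: "ideal {x \<in> carrier R. \<exists>s\<in>S. s \<otimes> x = \<zero>} R"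
    (is "ideal ?K R")
  unfolding submodule_regular_module_iff_ideal[symmetric]
proof (rule module.submoduleI_smult[OF module_regular_module])
  have "x \<oplus> y \<in> ?K" if xy: "x \<in> ?K" "y \<in> ?K" for x y
  proof -
    obtain s t where s: "s \<in> S" "s \<otimes> x = \<zero>" and t: "t \<in> S" "t \<otimes> y = \<zero>" using xy by blast
    have closed: "x \<in> carrier R" "y \<in> carrier R" "s \<in> carrier R" "t \<in> carrier R"
      using xy s t S_closed(1) by auto
    have "(s \<otimes> t) \<otimes> (x \<oplus> y) = t \<otimes> (s \<otimes> x) \<oplus> s \<otimes> (t \<otimes> y)" using closed by algebra
    then show ?thesis using s t closed S_closed(3) by auto
  qed
  then show "x \<oplus>\<^bsub>regular_module R\<^esub> y \<in> ?K" if "x \<in> ?K" "y \<in> ?K" for x y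
    using that by simp
  have "r \<otimes> x \<in> ?K" if rx: "r \<in> carrier R" "x \<in> ?K" for r x
  proof -
    obtain s where s: "s \<in> S" "s \<otimes> x = \<zero>" using rx by blast
    have "s \<otimes> (r \<otimes> x) = r \<otimes> (s \<otimes> x)" using rx s S_closed(1) by (simp add: m_lcomm)
    then show ?thesis using rx s by auto
  qed
  then show "r \<odot>\<^bsub>regular_module R\<^esub> x \<in> ?K" if "r \<in> carrier R" "x \<in> ?K" for r x
    using that by simp
qed (use S_closed in auto)

lemma localization_surj:
  assumes "\<And>s. s \<in> S \<Longrightarrow> \<exists>t\<in>S. t \<otimes> s = t"
  shows "(\<lambda>r. fraction r \<one>) ` carrier (regular_module R) = carrier (loc_module R S)"
proof
  show "(\<lambda>r. fraction r \<one>) ` carrier (regular_module R) \<subseteq> carrier (loc_module R S)"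
    using mod_hom_closed[OF mod_hom_localization] by auto
  have "fraction r s = fraction r \<one>" if "r \<in> carrier R" "s \<in> S" for r s
  proof -
    obtain t where t: "t \<in> S" "t \<otimes> s = t" using assms \<open>s \<in> S\<close> by blast
    have "t \<otimes> (r \<otimes> \<one> \<ominus> r \<otimes> s) = r \<otimes> t \<ominus> r \<otimes> (t \<otimes> s)"
      using that t S_closed(1) by algebra
    also have "\<dots> = \<zero>" using that t S_closed(1) by (simp add: a_minus_def r_neg)
    finally show ?thesis using that t S_closed(2) by (auto simp: fraction_eq_iff)
  qed
  then show "carrier (loc_module R S) \<subseteq> (\<lambda>r. fraction r \<one>) ` carrier (regular_module R)"
    by (auto simp: carrier_loc_module)
qed

lemma module_loc_module:
  assumes "\<And>s. s \<in> S \<Longrightarrow> \<exists>t\<in>S. t \<otimes> s = t"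
  shows "module R (loc_module R S)"
  by (rule module_surj_image[OF module_regular_module mod_hom_localization
        localization_surj[OF assms]])
    (simp_all add: zero_loc_module)

end

section \<open>Von Neumann regular rings\<close>

locale regular_ring = cring R for R :: "'a ring" (structure) +
  assumes von_neumann_regular: "von_neumann_regular R"
begin

lemma ideal_element_unit:
  assumes "ideal I R" "a \<in> I"
  obtains e where "e \<in> I" "a \<otimes> e = a"
proof -
  interpret ideal I R by fact
  have a: "a \<in> carrier R" using assms(2) by (rule a_Hcarr)
  then obtain b where b: "b \<in> carrier R" "a \<otimes> b \<otimes> a = a"
    using von_neumann_regular by (auto simp: von_neumann_regular_def)
  show thesis
  proof (rule that[of "a \<otimes> b"])
    show "a \<otimes> b \<in> I" using assms(2) b(1) by (rule I_r_closed)
    show "a \<otimes> (a \<otimes> b) = a" using a b by (simp add: m_ac)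
  qed
qed

lemma ideal_finite_unit:
  assumes "ideal I R" "finite A" "A \<subseteq> I"
  obtains e where "e \<in> I" "\<And>a. a \<in> A \<Longrightarrow> a \<otimes> e = a"
proof -
  interpret ideal I R by fact
  from assms(2,3) have "\<exists>e\<in>I. \<forall>a\<in>A. a \<otimes> e = a"
  proof induction
    case empty
    show ?case using additive_subgroup.zero_closed[OF is_additive_subgroup] by blast
  next
    case (insert a A)
    then obtain e where e: "e \<in> I" "\<And>x. x \<in> A \<Longrightarrow> x \<otimes> e = x" by auto
    obtain f where f: "f \<in> I" "a \<otimes> f = a"
      using ideal_element_unit[OF assms(1)] insert.prems by blast
    have join: "x \<otimes> (e \<oplus> f \<ominus> e \<otimes> f) = x" if "x \<in> insert a A" for x
    proof -
      have closed: "x \<in> carrier R" "e \<in> carrier R" "f \<in> carrier R"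
        using that insert.prems e f a_Hcarr by auto
      have "x \<otimes> e = x \<or> x \<otimes> f = x" using that e(2) f(2) by blast
      then show ?thesis
      proof
        assume xe: "x \<otimes> e = x"
        have "x \<otimes> (e \<oplus> f \<ominus> e \<otimes> f) = x \<otimes> e \<oplus> (x \<otimes> f \<ominus> x \<otimes> e \<otimes> f)"
          using closed by algebra
        then show ?thesis using closed xe by (simp add: a_minus_def r_neg)
      next
        assume xf: "x \<otimes> f = x"
        have "x \<otimes> (e \<oplus> f \<ominus> e \<otimes> f) = x \<otimes> f \<oplus> (x \<otimes> e \<ominus> (x \<otimes> f) \<otimes> e)"
          using closed by algebra
        then show ?thesis using closed xf by (simp add: a_minus_def r_neg)
      qed
    qed
    have "e \<oplus> f \<ominus> e \<otimes> f \<in> I"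
      using e(1) f(1) a_Hcarr by (simp add: a_minus_def I_r_closed)
    with join show ?case by blast
  qed
  then show thesis using that by blast
qed

end

lemma (in localization) genideal_eq_localization_kernel:
  assumes G: "G \<subseteq> carrier R"
    and complement: "\<And>s. s \<in> S \<Longrightarrow> \<one> \<ominus> s \<in> Idl G"
    and killed: "\<And>a. a \<in> G \<Longrightarrow> \<exists>s\<in>S. s \<otimes> a = \<zero>"
  shows "Idl G = {x \<in> carrier R. \<exists>s\<in>S. s \<otimes> x = \<zero>}"
proof
  show "Idl G \<subseteq> {x \<in> carrier R. \<exists>s\<in>S. s \<otimes> x = \<zero>}"
    using G killed by (intro genideal_minimal[OF ideal_localization_kernel]) auto
  interpret I: ideal "Idl G" R by (rule genideal_ideal[OF G])
  show "{x \<in> carrier R. \<exists>s\<in>S. s \<otimes> x = \<zero>} \<subseteq> Idl G"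
  proof clarify
    fix x s assume x: "x \<in> carrier R" "s \<in> S" "s \<otimes> x = \<zero>"
    have "x = (\<one> \<ominus> s) \<otimes> x \<oplus> s \<otimes> x" using x(1) S_closed(1)[OF x(2)] by algebra
    then have "x = (\<one> \<ominus> s) \<otimes> x" using x S_closed(1)[OF x(2)] by simp
    then show "x \<in> Idl G" using I.I_r_closed[OF complement[OF x(2)] x(1)] by simp
  qed
qed

text \<open>If $e_a \in I$ fixes the generator $a$ of $I$, then $R/I$ is the localization of $R$ at the
  products of the elements $1 - e_a$.\<close>
lemma (in regular_ring) countably_generated_ideal_localization:
  assumes "countable G" "G \<subseteq> carrier R"
  obtains S where "mult_subset R S" "countable S" "\<And>s. s \<in> S \<Longrightarrow> \<exists>t\<in>S. t \<otimes> s = t"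
    "Idl G = {x \<in> carrier R. \<exists>s\<in>S. s \<otimes> x = \<zero>}"
proof -
  have I: "ideal (Idl G) R" by (rule genideal_ideal[OF assms(2)])
  have I_carrier: "x \<in> carrier R" if "x \<in> Idl G" for x using ideal.Icarr[OF I that] .
  have "\<exists>e\<in>Idl G. a \<otimes> e = a" if "a \<in> G" for a
    using ideal_element_unit[OF I, of a] genideal_self[OF assms(2)] that by blast
  then obtain e where e: "\<And>a. a \<in> G \<Longrightarrow> e a \<in> Idl G" "\<And>a. a \<in> G \<Longrightarrow> a \<otimes> e a = a"
    by metis
  define S where "S = mult_gen R ((\<lambda>a. \<one> \<ominus> a) ` e ` G)"
  have eG: "e ` G \<subseteq> Idl G" using e(1) by blast
  have S: "mult_subset R S"
    unfolding S_def using eG I_carrier by (intro mult_subset_mult_gen[OF is_cring]) auto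
  interpret localization R S by unfold_locales (rule S)
  have complement: "\<one> \<ominus> s \<in> Idl G" if "s \<in> S" for s
    using that unfolding S_def by (rule mult_gen_complement[OF I eG])
  have killed: "\<exists>s\<in>S. s \<otimes> a = \<zero>" if a: "a \<in> G" for a
  proof (rule bexI)
    have closed: "a \<in> carrier R" "e a \<in> carrier R" using a e(1) I_carrier assms(2) by auto
    show "(\<one> \<ominus> e a) \<otimes> \<one> \<in> S" unfolding S_def using a by (intro mult_gen.intros) auto
    have "((\<one> \<ominus> e a) \<otimes> \<one>) \<otimes> a = a \<ominus> a \<otimes> e a" using closed by algebra
    then show "((\<one> \<ominus> e a) \<otimes> \<one>) \<otimes> a = \<zero>" using e(2)[OF a] closed by (simp add: a_minus_def r_neg)
  qed
  have kernel: "Idl G = {x \<in> carrier R. \<exists>s\<in>S. s \<otimes> x = \<zero>}"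
    by (rule genideal_eq_localization_kernel[OF assms(2) complement killed])
  show thesis
  proof (rule that[OF S _ _ kernel])
    show "countable S" unfolding S_def using assms(1) by (intro countable_mult_gen) simp
    show "\<exists>t\<in>S. t \<otimes> s = t" if s: "s \<in> S" for s
    proof -
      obtain t where t: "t \<in> S" "t \<otimes> (\<one> \<ominus> s) = \<zero>" using complement[OF s] kernel by blast
      have "t \<otimes> s = t \<ominus> t \<otimes> (\<one> \<ominus> s)" using s t(1) S_closed(1) by algebra
      then show ?thesis using t S_closed(1) by (auto simp: minus_zero_right)
    qed
  qed
qed

context regular_ring
begin

lemma finitely_generated_form_unit:
  assumes M: "module R M" and \<phi>: "mod_hom R M (regular_module R) \<phi>"
    and P: "finitely_generated R M P"
  obtains v where "v \<in> P" "\<And>u. u \<in> P \<Longrightarrow> \<phi> u \<otimes> \<phi> v = \<phi> u"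
proof -
  interpret M: module R M by fact
  obtain G where G: "finite G" "G \<subseteq> carrier M" "P = submodule_gen R M G"
    using P unfolding finitely_generated_def by blast
  have \<phi>_closed: "\<phi> u \<in> carrier R" if "u \<in> carrier M" for u using mod_hom_closed[OF \<phi> that] by simp
  have \<phi>G: "\<phi> ` G \<subseteq> carrier R" using G(2) \<phi>_closed by blast
  obtain e where e: "e \<in> Idl (\<phi> ` G)" "\<And>a. a \<in> \<phi> ` G \<Longrightarrow> a \<otimes> e = a"
    using ideal_finite_unit[OF genideal_ideal[OF \<phi>G] _ genideal_self[OF \<phi>G]] G(1) by blast
  then obtain v where v: "v \<in> P" "e = \<phi> v"
    using image_submodule_gen_ideal[OF M \<phi> G(2)] G(3) by blast
  have v_carrier: "v \<in> carrier M" using v(1) G submodule_gen_closed[OF M] by blast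
  have "submodule {u \<in> carrier M. \<phi> u \<otimes> \<phi> v = \<phi> u} R M"
    using \<phi>_closed v_carrier mod_hom_zero[OF M module_regular_module \<phi>]
    by (intro M.submoduleI_smult)
      (auto simp: mod_hom_add[OF \<phi>] mod_hom_smult[OF \<phi>] l_distr m_assoc)
  then have "P \<subseteq> {u \<in> carrier M. \<phi> u \<otimes> \<phi> v = \<phi> u}"
    unfolding G(3) using G(2) e(2) v(2) by (intro submodule_gen_minimal) auto
  with v(1) show thesis by (intro that) auto
qed

text \<open>If $\varphi(u) \varphi(v) = \varphi(u)$ for all $u \in P$, then
  $u \mapsto u - \varphi(u) v$ projects $P$ onto $P \cap \ker \varphi$.\<close>
lemma finitely_generated_form_kernel:
  assumes M: "module R M" and \<phi>: "mod_hom R M (regular_module R) \<phi>"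
    and P: "finitely_generated R M P"
  shows "finitely_generated R M {u \<in> P. \<phi> u = \<zero>}"
proof -
  interpret M: module R M by fact
  note P_closed = M.submoduleE(4,5)[OF finitely_generated_submodule[OF M P]]
    M.submoduleE(3)[OF finitely_generated_submodule[OF M P]]
  have P_carrier: "u \<in> carrier M" if "u \<in> P" for u
    using that M.submoduleE(1)[OF finitely_generated_submodule[OF M P]] by blast
  have \<phi>_closed: "\<phi> u \<in> carrier R" if "u \<in> carrier M" for u using mod_hom_closed[OF \<phi> that] by simp
  obtain v where v: "v \<in> P" "\<And>u. u \<in> P \<Longrightarrow> \<phi> u \<otimes> \<phi> v = \<phi> u"
    using finitely_generated_form_unit[OF M \<phi> P] by blast
  have \<phi>v: "mod_hom R M M (\<lambda>u. \<phi> u \<odot>\<^bsub>M\<^esub> v)"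
    using \<phi>_closed P_carrier[OF v(1)]
    by (intro mod_homI)
      (auto simp: mod_hom_add[OF \<phi>] mod_hom_smult[OF \<phi>] M.smult_l_distr M.smult_assoc1)
  define T where "T = (\<lambda>u. u \<ominus>\<^bsub>M\<^esub> \<phi> u \<odot>\<^bsub>M\<^esub> v)"
  have T: "mod_hom R M M T"
    unfolding T_def by (rule mod_hom_diff[OF M _ \<phi>v]) (auto intro: mod_homI)
  have "T ` P = {u \<in> P. \<phi> u = \<zero>}"
  proof (intro equalityI subsetI)
    fix y assume "y \<in> T ` P"
    then obtain u where u: "u \<in> P" "y = T u" by blast
    have "\<phi> y = \<phi> u \<ominus> \<phi> u \<otimes> \<phi> v"
      using u v(1) P_carrier \<phi>_closed
      by (simp add: T_def mod_hom_minus[OF M module_regular_module \<phi>] mod_hom_smult[OF \<phi>])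
    also have "\<dots> = \<zero>" using u P_carrier v(2) \<phi>_closed by (simp add: minus_eq_zero_iff)
    finally show "y \<in> {u \<in> P. \<phi> u = \<zero>}"
      using u v(1) P_closed \<phi>_closed P_carrier by (simp add: T_def a_minus_def)
  next
    fix y assume "y \<in> {u \<in> P. \<phi> u = \<zero>}"
    then have "y \<in> P" "T y = y" using v(1) P_carrier by (auto simp: T_def M.M.minus_zero_right)
    then show "y \<in> T ` P" by force
  qed
  then show ?thesis using finitely_generated_image[OF M M T P] by simp
qed

end

section \<open>The free module of countable rank\<close>

lemma free_nat_module_simps:
  "u \<in> carrier (free_nat_module R) \<longleftrightarrow> (\<forall>n. u n \<in> carrier R) \<and> finite {n. u n \<noteq> \<zero>\<^bsub>R\<^esub>}"
  "\<zero>\<^bsub>free_nat_module R\<^esub> = (\<lambda>n. \<zero>\<^bsub>R\<^esub>)"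
  "u \<oplus>\<^bsub>free_nat_module R\<^esub> v = (\<lambda>n. u n \<oplus>\<^bsub>R\<^esub> v n)"
  "r \<odot>\<^bsub>free_nat_module R\<^esub> u = (\<lambda>n. r \<otimes>\<^bsub>R\<^esub> u n)"
  by (simp_all add: free_nat_module_def)

lemma free_nat_module_closed: "u \<in> carrier (free_nat_module R) \<Longrightarrow> u n \<in> carrier R"
  by (simp add: free_nat_module_simps)

lemma free_nat_module_finite_support:
  "u \<in> carrier (free_nat_module R) \<Longrightarrow> finite {n. u n \<noteq> \<zero>\<^bsub>R\<^esub>}"
  by (simp add: free_nat_module_simps)

lemma free_nat_module_support_bound:
  assumes "u \<in> carrier (free_nat_module R)"
  obtains N where "\<And>m. m \<ge> N \<Longrightarrow> u m = \<zero>\<^bsub>R\<^esub>"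
proof -
  obtain N where "\<forall>m\<in>{n. u n \<noteq> \<zero>\<^bsub>R\<^esub>}. m < N"
    using free_nat_module_finite_support[OF assms] finite_nat_set_iff_bounded by blast
  then show ?thesis using that[of N] by force
qed

lemma module_free_nat_module:
  assumes "cring R"
  shows "module R (free_nat_module R)"
proof -
  interpret cring R by fact
  have fin: "finite {n. f n \<noteq> \<zero>\<^bsub>R\<^esub>}"
    if "finite {n. u n \<noteq> \<zero>\<^bsub>R\<^esub>}" "finite {n. v n \<noteq> \<zero>\<^bsub>R\<^esub>}"
      "\<And>n. u n = \<zero>\<^bsub>R\<^esub> \<Longrightarrow> v n = \<zero>\<^bsub>R\<^esub> \<Longrightarrow> f n = \<zero>\<^bsub>R\<^esub>" for u v f :: "nat \<Rightarrow> 'a"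
    using that by (intro finite_subset[of "{n. f n \<noteq> \<zero>\<^bsub>R\<^esub>}"
      "{n. u n \<noteq> \<zero>\<^bsub>R\<^esub>} \<union> {n. v n \<noteq> \<zero>\<^bsub>R\<^esub>}"]) auto
  show ?thesis
  proof (rule moduleI[OF assms abelian_groupI])
    fix u v assume "u \<in> carrier (free_nat_module R)" "v \<in> carrier (free_nat_module R)"
    then show "u \<oplus>\<^bsub>free_nat_module R\<^esub> v \<in> carrier (free_nat_module R)"
      using fin[of u v] by (simp add: free_nat_module_simps)
  next
    fix r u assume "r \<in> carrier R" "u \<in> carrier (free_nat_module R)"
    then show "r \<odot>\<^bsub>free_nat_module R\<^esub> u \<in> carrier (free_nat_module R)"
      using fin[of u u] by (simp add: free_nat_module_simps)
  next
    fix u assume "u \<in> carrier (free_nat_module R)"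
    then show "\<exists>v\<in>carrier (free_nat_module R). v \<oplus>\<^bsub>free_nat_module R\<^esub> u = \<zero>\<^bsub>free_nat_module R\<^esub>"
      using fin[of u u "\<lambda>n. \<ominus>\<^bsub>R\<^esub> u n"]
      by (intro bexI[of _ "\<lambda>n. \<ominus>\<^bsub>R\<^esub> u n"]) (auto simp: free_nat_module_simps l_neg)
  qed (auto simp: free_nat_module_simps a_ac m_ac l_distr r_distr)
qed

lemma mod_hom_coordinate: "mod_hom R (free_nat_module R) (regular_module R) (\<lambda>u. u n)"
  by (rule mod_homI) (auto simp: free_nat_module_simps)

definition unit_vec :: "'a ring \<Rightarrow> nat \<Rightarrow> nat \<Rightarrow> 'a" where
  "unit_vec R n = (\<lambda>m. if m = n then \<one>\<^bsub>R\<^esub> else \<zero>\<^bsub>R\<^esub>)"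

lemma range_unit_vec:
  assumes "cring R"
  shows "range (unit_vec R) \<subseteq> carrier (free_nat_module R)"
proof -
  interpret cring R by fact
  show ?thesis by (auto simp: unit_vec_def free_nat_module_simps)
qed

definition free_lift :: "'a ring \<Rightarrow> ('a,'b) module \<Rightarrow> (nat \<Rightarrow> 'b) \<Rightarrow> (nat \<Rightarrow> 'a) \<Rightarrow> 'b" where
  "free_lift R M c u = (\<Oplus>\<^bsub>M\<^esub>i\<in>{i. u i \<noteq> \<zero>\<^bsub>R\<^esub>}. u i \<odot>\<^bsub>M\<^esub> c i)"

lemma mod_hom_finsum:
  assumes "module R M" "module R N" and f: "mod_hom R M N f"
    and "finite A" "x \<in> A \<rightarrow> carrier M"
  shows "f (\<Oplus>\<^bsub>M\<^esub>i\<in>A. x i) = (\<Oplus>\<^bsub>N\<^esub>i\<in>A. f (x i))"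
proof -
  interpret M: module R M by fact
  interpret N: module R N by fact
  show ?thesis
    using assms(4,5)
  proof (induction rule: finite_induct)
    case empty
    then show ?case using mod_hom_zero[OF assms(1,2) f] by simp
  next
    case (insert a A)
    then show ?case
      using mod_hom_closed[OF f] by (simp add: mod_hom_add[OF f] Pi_iff)
  qed
qed

context
  fixes R :: "'a ring" and M :: "('a,'b) module" and c :: "nat \<Rightarrow> 'b"
  assumes M: "module R M" and c: "range c \<subseteq> carrier M"
begin

interpretation M: module R M by (rule M)

private lemmas c_closed = range_subsetD[OF c]

lemma free_lift_eq_finsum:
  assumes "u \<in> carrier (free_nat_module R)" "finite A" "{i. u i \<noteq> \<zero>\<^bsub>R\<^esub>} \<subseteq> A"
  shows "free_lift R M c u = (\<Oplus>\<^bsub>M\<^esub>i\<in>A. u i \<odot>\<^bsub>M\<^esub> c i)"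
  unfolding free_lift_def
  by (rule M.M.add.finprod_mono_neutral_cong_left)
    (use assms c_closed in \<open>auto simp: free_nat_module_closed\<close>)

lemma mod_hom_free_lift: "mod_hom R (free_nat_module R) M (free_lift R M c)"
proof (rule mod_homI)
  interpret free: module R "free_nat_module R" by (rule module_free_nat_module[OF M.is_cring])
  show "free_lift R M c u \<in> carrier M" if "u \<in> carrier (free_nat_module R)" for u
    unfolding free_lift_def using that c_closed by (auto simp: free_nat_module_closed)
  show "free_lift R M c (u \<oplus>\<^bsub>free_nat_module R\<^esub> v) = free_lift R M c u \<oplus>\<^bsub>M\<^esub> free_lift R M c v"
    if u: "u \<in> carrier (free_nat_module R)" and v: "v \<in> carrier (free_nat_module R)" for u v
  proof -
    define A where "A = {i. u i \<noteq> \<zero>\<^bsub>R\<^esub>} \<union> {i. v i \<noteq> \<zero>\<^bsub>R\<^esub>}"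
    have A: "finite A" using u v by (simp add: A_def free_nat_module_finite_support)
    have "free_lift R M c (u \<oplus>\<^bsub>free_nat_module R\<^esub> v)
        = (\<Oplus>\<^bsub>M\<^esub>i\<in>A. (u \<oplus>\<^bsub>free_nat_module R\<^esub> v) i \<odot>\<^bsub>M\<^esub> c i)"
      using free.M.a_closed[OF u v] A
      by (intro free_lift_eq_finsum) (auto simp: A_def free_nat_module_simps)
    also have "\<dots> = (\<Oplus>\<^bsub>M\<^esub>i\<in>A. u i \<odot>\<^bsub>M\<^esub> c i \<oplus>\<^bsub>M\<^esub> v i \<odot>\<^bsub>M\<^esub> c i)"
      using u v c_closed
      by (intro M.M.finsum_cong') (auto simp: free_nat_module_simps M.smult_l_distr)
    also have "\<dots> = (\<Oplus>\<^bsub>M\<^esub>i\<in>A. u i \<odot>\<^bsub>M\<^esub> c i) \<oplus>\<^bsub>M\<^esub> (\<Oplus>\<^bsub>M\<^esub>i\<in>A. v i \<odot>\<^bsub>M\<^esub> c i)"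
      using u v c_closed by (intro M.M.finsum_addf) (auto simp: free_nat_module_closed)
    also have "\<dots> = free_lift R M c u \<oplus>\<^bsub>M\<^esub> free_lift R M c v"
      using u v A by (simp add: free_lift_eq_finsum[of _ A] A_def)
    finally show ?thesis .
  qed
  show "free_lift R M c (r \<odot>\<^bsub>free_nat_module R\<^esub> u) = r \<odot>\<^bsub>M\<^esub> free_lift R M c u"
    if r: "r \<in> carrier R" and u: "u \<in> carrier (free_nat_module R)" for r u
  proof -
    let ?A = "{i. u i \<noteq> \<zero>\<^bsub>R\<^esub>}"
    have "free_lift R M c (r \<odot>\<^bsub>free_nat_module R\<^esub> u)
        = (\<Oplus>\<^bsub>M\<^esub>i\<in>?A. (r \<odot>\<^bsub>free_nat_module R\<^esub> u) i \<odot>\<^bsub>M\<^esub> c i)"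
      using free.smult_closed[OF r u] free_nat_module_finite_support[OF u] r
      by (intro free_lift_eq_finsum) (auto simp: free_nat_module_simps)
    also have "\<dots> = (\<Oplus>\<^bsub>M\<^esub>i\<in>?A. r \<odot>\<^bsub>M\<^esub> (u i \<odot>\<^bsub>M\<^esub> c i))"
      using r u c_closed
      by (intro M.M.finsum_cong') (auto simp: free_nat_module_simps M.smult_assoc1)
    also have "\<dots> = r \<odot>\<^bsub>M\<^esub> free_lift R M c u"
      unfolding free_lift_def using r u c_closed
      by (intro M.finsum_smult_ldistr[symmetric]) (auto simp: free_nat_module_simps)
    finally show ?thesis .
  qed
qed

lemma mod_hom_free_lift_comp:
  assumes "module R N" "mod_hom R M N f" "u \<in> carrier (free_nat_module R)"
  shows "f (free_lift R M c u) = free_lift R N (\<lambda>i. f (c i)) u"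
proof -
  interpret N: module R N by fact
  have "f (free_lift R M c u) = (\<Oplus>\<^bsub>N\<^esub>i\<in>{i. u i \<noteq> \<zero>\<^bsub>R\<^esub>}. f (u i \<odot>\<^bsub>M\<^esub> c i))"
    unfolding free_lift_def using assms(3) c_closed
    by (intro mod_hom_finsum[OF M assms(1,2)]) (auto simp: free_nat_module_simps)
  also have "\<dots> = free_lift R N (\<lambda>i. f (c i)) u"
    unfolding free_lift_def using assms(3) c_closed mod_hom_closed[OF assms(2)]
    by (intro N.M.finsum_cong') (auto simp: free_nat_module_simps mod_hom_smult[OF assms(2)])
  finally show ?thesis .
qed

lemma free_lift_cong:
  assumes "u \<in> carrier (free_nat_module R)" "\<And>i. u i \<noteq> \<zero>\<^bsub>R\<^esub> \<Longrightarrow> c' i = c i"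
  shows "free_lift R M c' u = free_lift R M c u"
  unfolding free_lift_def using assms c_closed
  by (intro M.M.finsum_cong') (auto simp: free_nat_module_closed)

lemma free_lift_upd:
  assumes u: "u \<in> carrier (free_nat_module R)" and y: "y \<in> carrier M"
  shows "free_lift R M (c(n := y)) u = free_lift R M (c(n := \<zero>\<^bsub>M\<^esub>)) u \<oplus>\<^bsub>M\<^esub> u n \<odot>\<^bsub>M\<^esub> y"
proof -
  define A where "A = {i. u i \<noteq> \<zero>\<^bsub>R\<^esub>} - {n}"
  have A: "finite A" "n \<notin> A" using free_nat_module_finite_support[OF u] by (auto simp: A_def)
  have rest: "(\<Oplus>\<^bsub>M\<^esub>i\<in>A. u i \<odot>\<^bsub>M\<^esub> (c(n := z)) i) = (\<Oplus>\<^bsub>M\<^esub>i\<in>A. u i \<odot>\<^bsub>M\<^esub> c i)" for z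
    using A(2) u c_closed by (intro M.M.finsum_cong') (auto simp: free_nat_module_closed)
  have rest_closed: "(\<Oplus>\<^bsub>M\<^esub>i\<in>A. u i \<odot>\<^bsub>M\<^esub> c i) \<in> carrier M"
    using u c_closed by (intro M.M.finsum_closed) (auto simp: free_nat_module_closed)
  have split: "free_lift R M (c(n := z)) u = (\<Oplus>\<^bsub>M\<^esub>i\<in>A. u i \<odot>\<^bsub>M\<^esub> c i) \<oplus>\<^bsub>M\<^esub> u n \<odot>\<^bsub>M\<^esub> z"
    if z: "z \<in> carrier M" for z
  proof -
    have "free_lift R M (c(n := z)) u = (\<Oplus>\<^bsub>M\<^esub>i\<in>insert n A. u i \<odot>\<^bsub>M\<^esub> (c(n := z)) i)"
      unfolding free_lift_def using u c_closed z A
      by (intro M.M.add.finprod_mono_neutral_cong_left) (auto simp: A_def free_nat_module_closed)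
    also have "\<dots> = u n \<odot>\<^bsub>M\<^esub> z \<oplus>\<^bsub>M\<^esub> (\<Oplus>\<^bsub>M\<^esub>i\<in>A. u i \<odot>\<^bsub>M\<^esub> (c(n := z)) i)"
      using u c_closed z A by (subst M.M.finsum_insert) (auto simp: free_nat_module_closed)
    also have "\<dots> = (\<Oplus>\<^bsub>M\<^esub>i\<in>A. u i \<odot>\<^bsub>M\<^esub> c i) \<oplus>\<^bsub>M\<^esub> u n \<odot>\<^bsub>M\<^esub> z"
      unfolding rest using u z rest_closed by (simp add: M.M.a_comm free_nat_module_closed)
    finally show ?thesis .
  qed
  show ?thesis
    using u y rest_closed by (simp add: split free_nat_module_closed)
qed

end

lemma free_lift_unit_vec:
  assumes "cring R" and u: "u \<in> carrier (free_nat_module R)"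
  shows "free_lift R (free_nat_module R) (unit_vec R) u = u"
proof
  interpret cring R by fact
  interpret reg: module R "regular_module R" by (rule module_regular_module)
  fix n
  have "free_lift R (free_nat_module R) (unit_vec R) u n
      = free_lift R (regular_module R) (\<lambda>i. unit_vec R i n) u"
    by (rule mod_hom_free_lift_comp[OF module_free_nat_module[OF assms(1)]
          range_unit_vec[OF assms(1)] module_regular_module mod_hom_coordinate u])
  also have "\<dots> = (\<Oplus>\<^bsub>regular_module R\<^esub>i\<in>insert n {i. u i \<noteq> \<zero>\<^bsub>R\<^esub>}. u i \<otimes>\<^bsub>R\<^esub> unit_vec R i n)"
    using u by (subst free_lift_eq_finsum[OF module_regular_module])
      (auto simp: unit_vec_def free_nat_module_finite_support)
  also have "\<dots> = (\<Oplus>\<^bsub>regular_module R\<^esub>i\<in>insert n {i. u i \<noteq> \<zero>\<^bsub>R\<^esub>}.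
      if n = i then u i else \<zero>\<^bsub>regular_module R\<^esub>)"
    using u by (intro reg.M.finsum_cong') (auto simp: unit_vec_def free_nat_module_closed)
  also have "\<dots> = u n"
    using u reg.M.finsum_singleton[of n "insert n {i. u i \<noteq> \<zero>\<^bsub>R\<^esub>}" u]
    by (simp add: free_nat_module_simps)
  finally show "free_lift R (free_nat_module R) (unit_vec R) u n = u n" .
qed

lemma mod_hom_eq_free_lift:
  assumes "module R M" "mod_hom R (free_nat_module R) M f" "u \<in> carrier (free_nat_module R)"
  shows "f u = free_lift R M (\<lambda>i. f (unit_vec R i)) u"
proof -
  interpret M: module R M by fact
  have "f (free_lift R (free_nat_module R) (unit_vec R) u) = free_lift R M (\<lambda>i. f (unit_vec R i)) u"
    by (rule mod_hom_free_lift_comp[OF module_free_nat_module[OF M.is_cring]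
          range_unit_vec[OF M.is_cring] assms])
  then show ?thesis using free_lift_unit_vec[OF M.is_cring assms(3)] by simp
qed

definition trunc :: "'a ring \<Rightarrow> nat \<Rightarrow> (nat \<Rightarrow> 'a) set \<Rightarrow> (nat \<Rightarrow> 'a) set" where
  "trunc R n P = {u \<in> P. \<forall>m\<ge>n. u m = \<zero>\<^bsub>R\<^esub>}"

lemma trunc_Suc_zero: "u \<in> trunc R (Suc n) P \<Longrightarrow> u n = \<zero>\<^bsub>R\<^esub> \<Longrightarrow> u \<in> trunc R n P"
  unfolding trunc_def by simp (metis Suc_leI le_neq_implies_less)

lemma submodule_trunc:
  assumes "cring R" and P: "submodule P R (free_nat_module R)"
  shows "submodule (trunc R n P) R (free_nat_module R)"
proof -
  interpret free: module R "free_nat_module R" by (rule module_free_nat_module[OF assms(1)])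
  note P_closed = free.submoduleE(1,4,5)[OF P] free.submodule_zero_closed[OF P]
  show ?thesis
    using P_closed
    by (intro free.submoduleI_smult) (auto simp: trunc_def free_nat_module_simps)
qed

lemma finitely_generated_support_bound:
  assumes "cring R" "finitely_generated R (free_nat_module R) P"
  obtains N where "trunc R N P = P"
proof -
  interpret free: module R "free_nat_module R" by (rule module_free_nat_module[OF assms(1)])
  obtain G where G: "finite G" "G \<subseteq> carrier (free_nat_module R)"
    "P = submodule_gen R (free_nat_module R) G"
    using assms(2) unfolding finitely_generated_def by blast
  have "finite (\<Union>g\<in>G. {n. g n \<noteq> \<zero>\<^bsub>R\<^esub>})"
    using G by (auto simp: free_nat_module_simps)
  then obtain N where "\<forall>m\<in>(\<Union>g\<in>G. {n. g n \<noteq> \<zero>\<^bsub>R\<^esub>}). m < N"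
    using finite_nat_set_iff_bounded by blast
  then have "G \<subseteq> trunc R N (carrier (free_nat_module R))"
    using G(2) by (force simp: trunc_def)
  then have "P \<subseteq> trunc R N (carrier (free_nat_module R))"
    unfolding G(3)
    by (rule submodule_gen_minimal[OF submodule_trunc[OF assms(1) free.carrier_is_submodule]])
  then show thesis by (intro that[of N]) (auto simp: trunc_def)
qed

lemma free_nat_module_projective:
  assumes B: "module R B" and F: "module R F"
    and g: "mod_hom R B F g" and surj: "g ` carrier B = carrier F"
    and \<pi>: "mod_hom R (free_nat_module R) F \<pi>"
  obtains \<beta> where "mod_hom R (free_nat_module R) B \<beta>"
    "\<And>u. u \<in> carrier (free_nat_module R) \<Longrightarrow> g (\<beta> u) = \<pi> u"
proof -
  interpret B: module R B by (rule B)
  have "\<exists>b\<in>carrier B. g b = \<pi> (unit_vec R i)" for i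
    using surj mod_hom_closed[OF \<pi> range_subsetD[OF range_unit_vec[OF B.is_cring]]]
    by (metis imageE)
  then obtain b where b: "range b \<subseteq> carrier B" "\<And>i. g (b i) = \<pi> (unit_vec R i)"
    by (metis image_subsetI)
  show thesis
  proof (rule that)
    show "mod_hom R (free_nat_module R) B (free_lift R B b)" by (rule mod_hom_free_lift[OF B b(1)])
    show "g (free_lift R B b u) = \<pi> u" if "u \<in> carrier (free_nat_module R)" for u
      using mod_hom_free_lift_comp[OF B b(1) F g that] mod_hom_eq_free_lift[OF F \<pi> that]
      by (simp add: b(2))
  qed
qed

section \<open>Splittings and the extension of linear maps\<close>

lemma splitting_if_kernel_map_extends:
  assumes L: "module R L" and F: "module R F" and B: "module R B"
    and f: "mod_hom R C B f" and g: "mod_hom R B F g"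
    and gf: "\<And>c. c \<in> carrier C \<Longrightarrow> g (f c) = \<zero>\<^bsub>F\<^esub>"
    and \<pi>: "mod_hom R L F \<pi>" and \<pi>_surj: "\<pi> ` carrier L = carrier F"
    and \<beta>: "mod_hom R L B \<beta>" and g\<beta>: "\<And>u. u \<in> carrier L \<Longrightarrow> g (\<beta> u) = \<pi> u"
    and H: "mod_hom R L C H" and fH: "\<And>u. u \<in> carrier L \<Longrightarrow> \<pi> u = \<zero>\<^bsub>F\<^esub> \<Longrightarrow> f (H u) = \<beta> u"
  shows "\<exists>s. mod_hom R F B s \<and> (\<forall>a\<in>carrier F. g (s a) = a)"
proof -
  interpret B: module R B by (rule B)
  interpret F: module R F by (rule F)
  define \<sigma> where "\<sigma> = (\<lambda>u. \<beta> u \<ominus>\<^bsub>B\<^esub> f (H u))"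
  have \<sigma>: "mod_hom R L B \<sigma>"
    unfolding \<sigma>_def by (rule mod_hom_diff[OF B \<beta> mod_hom_comp[OF H f]])
  have "\<sigma> u = \<zero>\<^bsub>B\<^esub>" if "u \<in> carrier L" "\<pi> u = \<zero>\<^bsub>F\<^esub>" for u
    using that fH mod_hom_closed[OF \<beta>] by (simp add: \<sigma>_def B.M.minus_eq_zero_iff)
  then obtain s where s: "mod_hom R F B s" "\<And>u. u \<in> carrier L \<Longrightarrow> s (\<pi> u) = \<sigma> u"
    using mod_hom_factor_surj[OF L F B \<pi> \<pi>_surj \<sigma>] by blast
  have "g (\<sigma> u) = \<pi> u" if "u \<in> carrier L" for u
    using that gf[OF mod_hom_closed[OF H]] g\<beta> mod_hom_closed[OF \<pi>]
    by (simp add: \<sigma>_def mod_hom_minus[OF B F g] mod_hom_closed[OF \<beta>]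
        mod_hom_closed[OF mod_hom_comp[OF H f]] F.M.minus_zero_right)
  then have "g (s a) = a" if "a \<in> carrier F" for a
    using that s(2) unfolding \<pi>_surj[symmetric] by auto
  with s(1) show ?thesis by blast
qed

lemma ext1_vanishes_if_kernel_maps_extend:
  fixes C :: "('a,'c) module" and F :: "('a,'f) module"
  assumes F: "module R F" and C: "module R C"
    and \<pi>: "mod_hom R (free_nat_module R) F \<pi>"
    and \<pi>_surj: "\<pi> ` carrier (free_nat_module R) = carrier F"
    and extend: "\<And>h. mod_hom R (free_nat_module R\<lparr>carrier :=
        {u \<in> carrier (free_nat_module R). \<pi> u = \<zero>\<^bsub>F\<^esub>}\<rparr>) C h \<Longrightarrow>
      \<exists>H. mod_hom R (free_nat_module R) C H \<and>
        (\<forall>u\<in>carrier (free_nat_module R). \<pi> u = \<zero>\<^bsub>F\<^esub> \<longrightarrow> H u = h u)"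
  shows "ext1_vanishes R F C"
  unfolding ext1_vanishes_def
proof (intro allI impI, elim conjE)
  fix B :: "('a, 'c \<times> 'f) module" and f g
  assume B: "module R B" and f: "mod_hom R C B f" and g: "mod_hom R B F g"
    and f_inj: "inj_on f (carrier C)" and g_surj: "g ` carrier B = carrier F"
    and kernel: "f ` carrier C = {b \<in> carrier B. g b = \<zero>\<^bsub>F\<^esub>}"
  interpret F: module R F by (rule F)
  let ?L = "free_nat_module R"
  let ?K = "{u \<in> carrier ?L. \<pi> u = \<zero>\<^bsub>F\<^esub>}"
  have L: "module R ?L" by (rule module_free_nat_module[OF F.is_cring])
  have K: "module R (?L\<lparr>carrier := ?K\<rparr>)"
    by (rule submodule.submodule_is_module[OF submodule_kernel[OF L F \<pi>] L])
  obtain \<beta> where \<beta>: "mod_hom R ?L B \<beta>" "\<And>u. u \<in> carrier ?L \<Longrightarrow> g (\<beta> u) = \<pi> u"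
    using free_nat_module_projective[OF B F g g_surj \<pi>] by blast
  then have "\<beta> ` carrier (?L\<lparr>carrier := ?K\<rparr>) \<subseteq> f ` carrier C"
    unfolding kernel using mod_hom_closed[OF \<beta>(1)] by auto
  then obtain h where h: "mod_hom R (?L\<lparr>carrier := ?K\<rparr>) C h" "\<And>u. u \<in> ?K \<Longrightarrow> f (h u) = \<beta> u"
    using mod_hom_factor_inj[OF K C f f_inj mod_hom_restrict[OF \<beta>(1), of ?K]] by auto
  obtain H where H: "mod_hom R ?L C H" "\<And>u. u \<in> ?K \<Longrightarrow> H u = h u" using extend[OF h(1)] by blast
  have gf: "g (f c) = \<zero>\<^bsub>F\<^esub>" if "c \<in> carrier C" for c using kernel that by blast
  show "\<exists>s. mod_hom R F B s \<and> (\<forall>a\<in>carrier F. g (s a) = a)"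
    by (rule splitting_if_kernel_map_extends[OF L F B f g gf \<pi> \<pi>_surj \<beta> H(1)])
      (auto simp: H(2) h(2))
qed

section \<open>Linear maps into almost cotorsion modules\<close>

definition represents ::
  "'a ring \<Rightarrow> ('a,'c) module \<Rightarrow> (nat \<Rightarrow> 'a) set \<Rightarrow> ((nat \<Rightarrow> 'a) \<Rightarrow> 'c) \<Rightarrow> (nat \<Rightarrow> 'c) \<Rightarrow> bool" where
  "represents R C P h c \<longleftrightarrow> range c \<subseteq> carrier C \<and> (\<forall>u\<in>P. h u = free_lift R C c u)"

lemma represents_trunc_0:
  assumes C: "module R C" and K: "submodule K R (free_nat_module R)"
    and h: "mod_hom R (free_nat_module R\<lparr>carrier := K\<rparr>) C h"
  shows "represents R C (trunc R 0 K) h (\<lambda>_. \<zero>\<^bsub>C\<^esub>)"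
proof -
  interpret C: module R C by (rule C)
  have free: "module R (free_nat_module R)" by (rule module_free_nat_module[OF C.is_cring])
  have zero_closed: "range (\<lambda>_. \<zero>\<^bsub>C\<^esub>) \<subseteq> carrier C" by auto
  have "u = \<zero>\<^bsub>free_nat_module R\<^esub>" if "u \<in> trunc R 0 K" for u
    using that by (auto simp: trunc_def free_nat_module_simps)
  then show ?thesis
    using zero_closed mod_hom_zero[OF submodule.submodule_is_module[OF K free] C h]
      mod_hom_zero[OF free C mod_hom_free_lift[OF C zero_closed]]
    by (auto simp: represents_def)
qed

lemma represents_trunc_upd_zero:
  assumes C: "module R C" and c: "represents R C (trunc R n K) h c"
    and u: "u \<in> trunc R (Suc n) K" "u n = \<zero>\<^bsub>R\<^esub>" "u \<in> carrier (free_nat_module R)"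
  shows "h u = free_lift R C (c(n := \<zero>\<^bsub>C\<^esub>)) u"
proof -
  interpret C: module R C by (rule C)
  have closed: "range (c(n := \<zero>\<^bsub>C\<^esub>)) \<subseteq> carrier C" using c by (auto simp: represents_def)
  have "h u = free_lift R C c u"
    using c trunc_Suc_zero[OF u(1,2)] by (auto simp: represents_def)
  also have "\<dots> = free_lift R C (c(n := \<zero>\<^bsub>C\<^esub>)) u"
    using u(2) by (intro free_lift_cong[OF C closed u(3)]) auto
  finally show ?thesis .
qed

lemma represents_limit:
  assumes C: "module R C" and K: "K \<subseteq> carrier (free_nat_module R)"
    and f: "\<And>n. represents R C (trunc R n K) h (f n)"
    and stable: "\<And>n i. i < n \<Longrightarrow> f (Suc n) i = f n i"
  shows "represents R C K h (\<lambda>i. f (Suc i) i)"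
proof -
  have closed: "range (\<lambda>i. f (Suc i) i) \<subseteq> carrier C"
    using f by (auto simp: represents_def)
  have limit: "f n i = f (Suc i) i" if "i < n" for n i
    using that by (induction n) (auto simp: stable less_Suc_eq)
  have "h u = free_lift R C (\<lambda>i. f (Suc i) i) u" if "u \<in> K" for u
  proof -
    have u: "u \<in> carrier (free_nat_module R)" using that K by blast
    obtain N where N: "\<And>m. m \<ge> N \<Longrightarrow> u m = \<zero>\<^bsub>R\<^esub>" using free_nat_module_support_bound[OF u] by blast
    then have "h u = free_lift R C (f N) u"
      using f[of N] that by (simp add: represents_def trunc_def)
    also have "\<dots> = free_lift R C (\<lambda>i. f (Suc i) i) u"
      using N by (intro free_lift_cong[OF C closed u] limit) (meson not_le)
    finally show ?thesis .
  qed
  with closed show ?thesis by (simp add: represents_def)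
qed

context regular_ring
begin

sublocale free: module R "free_nat_module R"
  by (rule module_free_nat_module[OF is_cring])

lemma finitely_generated_vanishing:
  assumes "finite A" "finitely_generated R (free_nat_module R) P"
  shows "finitely_generated R (free_nat_module R) {u \<in> P. \<forall>m\<in>A. u m = \<zero>}"
  using assms(1)
proof induction
  case empty
  then show ?case using assms(2) by simp
next
  case (insert a A)
  have "{u \<in> P. \<forall>m\<in>insert a A. u m = \<zero>} = {u \<in> {u \<in> P. \<forall>m\<in>A. u m = \<zero>}. u a = \<zero>}" by auto
  then show ?case
    using finitely_generated_form_kernel[OF free.module_axioms mod_hom_coordinate insert.IH] by simp
qed

lemma finitely_generated_trunc:
  assumes "finitely_generated R (free_nat_module R) P"
  shows "finitely_generated R (free_nat_module R) (trunc R n P)"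
proof -
  obtain N where N: "trunc R N P = P" by (rule finitely_generated_support_bound[OF is_cring assms])
  have "u m = \<zero>" if "u \<in> P" "m \<ge> N" for u m using that N by (auto simp: trunc_def)
  then have "trunc R n P = {u \<in> P. \<forall>m\<in>{n..<N}. u m = \<zero>}"
    by (auto simp: trunc_def)
  then show ?thesis using finitely_generated_vanishing[OF _ assms, of "{n..<N}"] by simp
qed

lemma countably_generated_trunc:
  assumes "countably_generated R (free_nat_module R) K"
  shows "countably_generated R (free_nat_module R) (trunc R n K)"
proof -
  let ?L = "free_nat_module R"
  obtain G where G: "countable G" "G \<subseteq> carrier ?L" "K = submodule_gen R ?L G"
    using assms unfolding countably_generated_def by blast
  let ?A = "{A. finite A \<and> A \<subseteq> G}"
  have "K = (\<Union>A\<in>?A. submodule_gen R ?L A)"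
    unfolding G(3) by (rule submodule_gen_finitary[OF free.module_axioms G(2)])
  then have eq: "trunc R n K = (\<Union>A\<in>?A. trunc R n (submodule_gen R ?L A))"
    by (auto simp: trunc_def)
  have "finitely_generated R ?L (submodule_gen R ?L A)" if "A \<in> ?A" for A
    using that G(2) unfolding finitely_generated_def by blast
  then have "finitely_generated R ?L (trunc R n (submodule_gen R ?L A))" if "A \<in> ?A" for A
    using that finitely_generated_trunc by blast
  moreover have "submodule (trunc R n K) R ?L"
    by (rule submodule_trunc[OF is_cring
          countably_generated_submodule[OF free.module_axioms assms]])
  ultimately show ?thesis
    unfolding eq using G(1)
    by (intro countably_generated_UN[OF free.module_axioms] countable_Collect_finite_subset) auto
qed

lemma almost_cotorsion_ideal_map:
  fixes C :: "('a,'c) module"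
  assumes C: "module R C" and cotorsion: "almost_cotorsion R C"
    and G: "countable G" "G \<subseteq> carrier R"
    and d: "mod_hom R (regular_module R\<lparr>carrier := Idl G\<rparr>) C d"
  obtains y where "y \<in> carrier C" "\<And>x. x \<in> Idl G \<Longrightarrow> d x = x \<odot>\<^bsub>C\<^esub> y"
proof -
  obtain S where S: "mult_subset R S" "countable S" "\<And>s. s \<in> S \<Longrightarrow> \<exists>t\<in>S. t \<otimes> s = t"
    and kernel: "Idl G = {x \<in> carrier R. \<exists>s\<in>S. s \<otimes> x = \<zero>}"
    using countably_generated_ideal_localization[OF G] by blast
  interpret localization R S by unfold_locales (rule S(1))
  have ext: "ext1_vanishes R (loc_module R S) C"
    using cotorsion S(1,2) unfolding almost_cotorsion_def by blast
  have ideal: "Idl G = {x \<in> carrier (regular_module R). fraction x \<one> = \<zero>\<^bsub>loc_module R S\<^esub>}"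
    unfolding kernel using localization_kernel by auto
  obtain H where H: "mod_hom R (regular_module R) C H"
    "\<And>x. x \<in> carrier (regular_module R) \<Longrightarrow> fraction x \<one> = \<zero>\<^bsub>loc_module R S\<^esub> \<Longrightarrow> H x = d x"
    using ext1_vanishes_extend[OF ext module_regular_module module_loc_module[OF S(3)] C
        mod_hom_localization localization_surj[OF S(3)] d[unfolded ideal]] by blast
  show thesis
  proof (rule that)
    show "H \<one> \<in> carrier C" using mod_hom_closed[OF H(1)] by simp
    fix x assume x: "x \<in> Idl G"
    then have "x \<in> carrier R" unfolding ideal by simp
    then have "H x = x \<odot>\<^bsub>C\<^esub> H \<one>" using mod_hom_smult[OF H(1), of x \<one>] by simp
    then show "d x = x \<odot>\<^bsub>C\<^esub> H \<one>" using x H(2) unfolding ideal by simp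
  qed
qed

lemma almost_cotorsion_form_multiple:
  fixes C :: "('a,'c) module" and M :: "('a,'m) module"
  assumes C: "module R C" and cotorsion: "almost_cotorsion R C" and M: "module R M"
    and \<phi>: "mod_hom R M (regular_module R) \<phi>" and L: "countably_generated R M L"
    and D: "mod_hom R (M\<lparr>carrier := L\<rparr>) C D"
    and D_zero: "\<And>u. u \<in> L \<Longrightarrow> \<phi> u = \<zero> \<Longrightarrow> D u = \<zero>\<^bsub>C\<^esub>"
  obtains y where "y \<in> carrier C" "\<And>u. u \<in> L \<Longrightarrow> D u = \<phi> u \<odot>\<^bsub>C\<^esub> y"
proof -
  obtain G where G: "countable G" "G \<subseteq> carrier M" "L = submodule_gen R M G"
    using L unfolding countably_generated_def by blast
  have sub_L: "submodule L R M" by (rule countably_generated_submodule[OF M L])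
  have L_carrier: "L \<subseteq> carrier M" by (rule module.submoduleE(1)[OF M sub_L])
  define I where "I = Idl (\<phi> ` G)"
  have \<phi>G: "countable (\<phi> ` G)" "\<phi> ` G \<subseteq> carrier R"
    using G(1,2) mod_hom_closed[OF \<phi>] by auto
  have image: "\<phi> ` L = I" unfolding I_def G(3) by (rule image_submodule_gen_ideal[OF M \<phi> G(2)])
  have I: "module R (regular_module R\<lparr>carrier := I\<rparr>)"
    using genideal_ideal[OF \<phi>G(2)]
    unfolding I_def submodule_regular_module_iff_ideal[symmetric]
    by (rule submodule.submodule_is_module[OF _ module_regular_module])
  have \<phi>_L: "mod_hom R (M\<lparr>carrier := L\<rparr>) (regular_module R\<lparr>carrier := I\<rparr>) \<phi>"
    using mod_hom_onto_image[OF mod_hom_restrict[OF \<phi> L_carrier]] by (simp add: image)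
  obtain d where d: "mod_hom R (regular_module R\<lparr>carrier := I\<rparr>) C d" "\<And>u. u \<in> L \<Longrightarrow> d (\<phi> u) = D u"
    using mod_hom_factor_surj[OF submodule.submodule_is_module[OF sub_L M] I C \<phi>_L _ D]
    by (simp add: image D_zero) blast
  obtain y where y: "y \<in> carrier C" "\<And>x. x \<in> I \<Longrightarrow> d x = x \<odot>\<^bsub>C\<^esub> y"
    using almost_cotorsion_ideal_map[OF C cotorsion \<phi>G] d(1) unfolding I_def by blast
  have "D u = \<phi> u \<odot>\<^bsub>C\<^esub> y" if "u \<in> L" for u
    using that d(2) y(2) image by (metis imageI)
  with y(1) show thesis by (rule that)
qed

lemma almost_cotorsion_represents_Suc:
  fixes C :: "('a,'c) module"
  assumes C: "module R C" and cotorsion: "almost_cotorsion R C"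
    and K: "countably_generated R (free_nat_module R) K"
    and h: "mod_hom R (free_nat_module R\<lparr>carrier := K\<rparr>) C h"
    and c: "represents R C (trunc R n K) h c"
  obtains y where "represents R C (trunc R (Suc n) K) h (c(n := y))"
proof -
  interpret C: module R C by (rule C)
  let ?L = "trunc R (Suc n) K"
  have L: "countably_generated R (free_nat_module R) ?L" by (rule countably_generated_trunc[OF K])
  have L_carrier: "?L \<subseteq> carrier (free_nat_module R)"
    by (rule free.submoduleE(1)[OF countably_generated_submodule[OF free.module_axioms L]])
  define c0 where "c0 = c(n := \<zero>\<^bsub>C\<^esub>)"
  have c_closed: "range c \<subseteq> carrier C" "range c0 \<subseteq> carrier C"
    using c by (auto simp: represents_def c0_def)
  note c0_lift = mod_hom_free_lift[OF C c_closed(2)]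
  have h_L: "mod_hom R (free_nat_module R\<lparr>carrier := ?L\<rparr>) C h"
    using mod_hom_restrict[OF h, of ?L] by (auto simp: trunc_def)
  define D where "D = (\<lambda>u. h u \<ominus>\<^bsub>C\<^esub> free_lift R C c0 u)"
  have D: "mod_hom R (free_nat_module R\<lparr>carrier := ?L\<rparr>) C D"
    unfolding D_def by (rule mod_hom_diff[OF C h_L mod_hom_restrict[OF c0_lift L_carrier]])
  have D_zero: "D u = \<zero>\<^bsub>C\<^esub>" if "u \<in> ?L" "u n = \<zero>" for u
    using represents_trunc_upd_zero[OF C c that] that(1) L_carrier mod_hom_closed[OF h_L, of u]
    by (simp add: D_def c0_def C.M.minus_eq_zero_iff subset_iff)
  obtain y where y: "y \<in> carrier C" "\<And>u. u \<in> ?L \<Longrightarrow> D u = u n \<odot>\<^bsub>C\<^esub> y"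
    using almost_cotorsion_form_multiple[OF C cotorsion free.module_axioms mod_hom_coordinate L D
        D_zero] by blast
  have "h u = free_lift R C (c(n := y)) u" if "u \<in> ?L" for u
  proof -
    have u: "u \<in> carrier (free_nat_module R)" using that L_carrier by blast
    have "h u = free_lift R C c0 u \<oplus>\<^bsub>C\<^esub> D u"
      using that u mod_hom_closed[OF h_L] mod_hom_closed[OF c0_lift]
      by (simp add: D_def a_minus_def C.M.a_lcomm C.M.r_neg)
    then show ?thesis
      using free_lift_upd[OF C c_closed(1) u y(1), of n] y(2)[OF that] by (simp add: c0_def)
  qed
  then show thesis using y(1) c_closed(1) by (intro that[of y]) (auto simp: represents_def)
qed

lemma almost_cotorsion_represents:
  fixes C :: "('a,'c) module"
  assumes C: "module R C" and cotorsion: "almost_cotorsion R C"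
    and K: "countably_generated R (free_nat_module R) K"
    and h: "mod_hom R (free_nat_module R\<lparr>carrier := K\<rparr>) C h"
  obtains c where "represents R C K h c"
proof -
  have sub_K: "submodule K R (free_nat_module R)"
    by (rule countably_generated_submodule[OF free.module_axioms K])
  have extend: "\<exists>c'. represents R C (trunc R (Suc n) K) h c' \<and> (\<forall>i<n. c' i = c i)"
    if c: "represents R C (trunc R n K) h c" for c n
  proof -
    obtain y where "represents R C (trunc R (Suc n) K) h (c(n := y))"
      using almost_cotorsion_represents_Suc[OF C cotorsion K h c] by blast
    then show ?thesis by (intro exI[of _ "c(n := y)"]) auto
  qed
  obtain f where f: "\<And>n. represents R C (trunc R n K) h (f n)"
    "\<And>n i. i < n \<Longrightarrow> f (Suc n) i = f n i"
    using dependent_nat_choice[of "\<lambda>n. represents R C (trunc R n K) h" "\<lambda>n c c'. \<forall>i<n. c' i = c i"]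
      represents_trunc_0[OF C sub_K h] extend by blast
  show thesis by (rule that[OF represents_limit[OF C free.submoduleE(1)[OF sub_K] f]])
qed

lemma countably_presented_ext1_vanishes:
  fixes C :: "('a,'c) module" and F :: "('a,'f) module"
  assumes F: "module R F" and presented: "countably_presented R F"
    and C: "module R C" and cotorsion: "almost_cotorsion R C"
  shows "ext1_vanishes R F C"
proof -
  let ?L = "free_nat_module R"
  obtain \<pi> where \<pi>: "mod_hom R ?L F \<pi>" "\<pi> ` carrier ?L = carrier F"
    and K: "countably_generated R ?L {u \<in> carrier ?L. \<pi> u = \<zero>\<^bsub>F\<^esub>}"
    using presented unfolding countably_presented_def countably_generated_def by blast
  show ?thesis
  proof (rule ext1_vanishes_if_kernel_maps_extend[OF F C \<pi>])
    fix h assume h: "mod_hom R (?L\<lparr>carrier := {u \<in> carrier ?L. \<pi> u = \<zero>\<^bsub>F\<^esub>}\<rparr>) C h"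
    obtain c where "represents R C {u \<in> carrier ?L. \<pi> u = \<zero>\<^bsub>F\<^esub>} h c"
      using almost_cotorsion_represents[OF C cotorsion K h] by blast
    then have c: "range c \<subseteq> carrier C"
      "\<And>u. u \<in> carrier ?L \<Longrightarrow> \<pi> u = \<zero>\<^bsub>F\<^esub> \<Longrightarrow> h u = free_lift R C c u"
      by (auto simp: represents_def)
    show "\<exists>H. mod_hom R ?L C H \<and> (\<forall>u\<in>carrier ?L. \<pi> u = \<zero>\<^bsub>F\<^esub> \<longrightarrow> H u = h u)"
      using mod_hom_free_lift[OF C c(1)] c(2) by (intro exI[of _ "free_lift R C c"]) simp
  qed
qed

end

theorem theorem4p14:
  fixes R :: "'a ring"
  assumes "cring R"
    and "von_neumann_regular R"
  shows "CFQ R TYPE('f) TYPE('c)"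
proof -
  interpret regular_ring R
    using assms by (simp add: regular_ring_def regular_ring_axioms_def)
  show ?thesis
    unfolding CFQ_def quite_flat_def using countably_presented_ext1_vanishes by blast
qed

end
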